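(* Let $\Sigma$ be a one-sided shift space over a countable alphabet that satisfies both (1) (finite cyclic predecessor assumption) $\mathscr{P}(a)\cap\mathscr{F}_m(a)$ is finite for every $a\in\mathscr{L}_1$ and for all $m\ge1$; (2) (denseness of periodic measures) the set of ergodic probabilities supported on periodic orbits of $\Sigma$ is weak$^\ast$ dense in the set of $\sigma$-invariant Borel probability measures on $\Sigma$. Let $(\hat\Sigma,\hat\sigma)$ be the blur shift associated with $\Sigma$ with a finite resolution of blurred sets $\mathscr{V}=\{B_1,\ldots,B_s\}$. Then $\mathcal{M}(\hat\Sigma,\hat\sigma)$ is weak$^\ast$ compact.
   Context: The countable alphabet $\mathscr{A}$ is identified with the non-negative integers (discrete topology); $\Sigma\subset\mathscr{A}^{\mathbb{N}}$ is a one-sided shift space (closed, shift-invariant, product topology), points are $x=(x_0,x_1,\ldots)$, and $\sigma$ is the left shift. $\mathscr{L}_0=\{\epsilon\}$ (empty word), $\mathscr{L}_k=\{(x_0,\ldots,x_{k-1}):x\in\Sigma\}$ for $k\ge1$, $\mathscr{L}=\bigcup_{k\ge0}\mathscr{L}_k$; $\ell(w)$ is the length of $w$. For $w\in\mathscr{L}$: $\mathscr{P}(w)=\{a\in\mathscr{L}_1:aw\in\mathscr{L}\}$, $\mathscr{F}_1(w)=\{b\in\mathscr{L}_1:wb\in\mathscr{L}\}$ (so $\mathscr{F}_1(\epsilon)=\mathscr{L}_1$), and for $m\ge2$, $\mathscr{F}_m(w)=\{b\in\mathscr{L}_1:wvb\in\mathscr{L}\text{ for some }v\in\mathscr{L}_{m-1}\}$.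 Blur shift: a finite resolution of blurred sets is $\mathscr{V}=\{B_1,\ldots,B_s\}$ where each $B_r\subset\mathscr{L}_1$ is infinite, $B_i\cap B_j$ is finite for $i\ne j$, and $\mathscr{L}_1\setminus\bigcup_{r}B_r$ is finite. Each $B_r$ is treated as a new symbol, and $\hat\Sigma=\Sigma\sqcup\partial_{B_1}\Sigma\sqcup\cdots\sqcup\partial_{B_s}\Sigma$, where $\partial_{B_r}\Sigma=\{(w,B_r,B_r,\ldots):w\in\mathscr{L},\ \mathscr{F}_1(w)\cap B_r\text{ infinite}\}$ (with $(\epsilon,B_r,B_r,\ldots)=(B_r,B_r,\ldots)$). The topology of $\hat\Sigma$ has as basis the generalized cylinders $Z[w]=\{x\in\hat\Sigma:x_i=w_i,\ 0\le i<\ell(w)\}$ and $Z[wB_r;S]=\{x\in\hat\Sigma:x_i=w_i\text{ for }0\le i<\ell(w),\ x_{\ell(w)}=B_r\text{ or }x_{\ell(w)}\in B_r\setminus S\}$, with $w\in\mathscr{L}$, $1\le r\le s$, $S\subset B_r$ finite; this makes $\hat\Sigma$ a compact metrizable space in which $\Sigma$ is a dense topological subspace. $\hat\sigma:\hat\Sigma\to\hat\Sigma$ is the left shift map (measurable, not continuous at the points $(B_r,B_r,\ldots)$). $\mathcal{M}(\hat\Sigma,\hat\sigma)$ is the set of $\hat\sigma$-invariant Borel probabilities on $\hat\Sigma$, as a subset of the space of all Borel probabilities on $\hat\Sigma$ with the weak$^\ast$ topology. *)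

theory Defs
  imports "HOL-Probability.Probability"
begin

section \<open>One-sided shift spaces over a countable alphabet\<close>

definition left_shift :: "(nat \<Rightarrow> 'a) \<Rightarrow> nat \<Rightarrow> 'a" where
  "left_shift x = (\<lambda>i. x (Suc i))"

text \<open>The type \<^typ>\<open>nat \<Rightarrow> nat\<close> carries the product of the discrete topologies.\<close>

definition shift_space :: "(nat \<Rightarrow> nat) set \<Rightarrow> bool" where
  "shift_space X \<longleftrightarrow> closed X \<and> left_shift ` X \<subseteq> X"

definition words :: "(nat \<Rightarrow> nat) set \<Rightarrow> nat \<Rightarrow> nat list set" where
  "words X k = (if k = 0 then {[]} else {map x [0..<k] | x. x \<in> X})"

definition language :: "(nat \<Rightarrow> nat) set \<Rightarrow> nat list set" where
  "language X = (\<Union>k. words X k)"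

definition letters :: "(nat \<Rightarrow> nat) set \<Rightarrow> nat set" where
  "letters X = {a. [a] \<in> words X 1}"

definition predecessors :: "(nat \<Rightarrow> nat) set \<Rightarrow> nat list \<Rightarrow> nat set" where
  "predecessors X w = {a \<in> letters X. a # w \<in> language X}"

text \<open>Only \<open>m \<ge> 1\<close> is meaningful; for \<open>m = 1\<close> the intermediate word \<open>v\<close> is empty.\<close>

definition followers :: "(nat \<Rightarrow> nat) set \<Rightarrow> nat \<Rightarrow> nat list \<Rightarrow> nat set" where
  "followers X m w = {b \<in> letters X. \<exists>v \<in> words X (m - 1). w @ v @ [b] \<in> language X}"


section \<open>Blur shifts\<close>

definition finite_resolution :: "(nat \<Rightarrow> nat) set \<Rightarrow> nat set set \<Rightarrow> bool" where
  "finite_resolution X V \<longleftrightarrow>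
     finite V \<and>
     (\<forall>B\<in>V. B \<subseteq> letters X \<and> infinite B) \<and>
     (\<forall>B\<in>V. \<forall>C\<in>V. B \<noteq> C \<longrightarrow> finite (B \<inter> C)) \<and>
     finite (letters X - \<Union>V)"

datatype symbol = Letter nat | Blur "nat set"

definition boundary_point :: "nat list \<Rightarrow> nat set \<Rightarrow> nat \<Rightarrow> symbol" where
  "boundary_point w B = (\<lambda>i. if i < length w then Letter (w ! i) else Blur B)"

definition boundary :: "(nat \<Rightarrow> nat) set \<Rightarrow> nat set \<Rightarrow> (nat \<Rightarrow> symbol) set" where
  "boundary X B =
     {boundary_point w B | w. w \<in> language X \<and> infinite (followers X 1 w \<inter> B)}"

definition blur_space :: "(nat \<Rightarrow> nat) set \<Rightarrow> nat set set \<Rightarrow> (nat \<Rightarrow> symbol) set" where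
  "blur_space X V = (\<lambda>x i. Letter (x i)) ` X \<union> (\<Union>B\<in>V. boundary X B)"

definition cylinder ::
  "(nat \<Rightarrow> nat) set \<Rightarrow> nat set set \<Rightarrow> nat list \<Rightarrow> (nat \<Rightarrow> symbol) set" where
  "cylinder X V w = {x \<in> blur_space X V. \<forall>i < length w. x i = Letter (w ! i)}"

definition blur_cylinder ::
  "(nat \<Rightarrow> nat) set \<Rightarrow> nat set set \<Rightarrow> nat list \<Rightarrow> nat set \<Rightarrow> nat set \<Rightarrow> (nat \<Rightarrow> symbol) set" where
  "blur_cylinder X V w B S =
     {x \<in> cylinder X V w. x (length w) = Blur B \<or> x (length w) \<in> Letter ` (B - S)}"

text \<open>The intersection of two generalized cylinders is a union of generalized cylinders, so
  the generating family below is a base and not merely a subbase.\<close>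

definition blur_topology :: "(nat \<Rightarrow> nat) set \<Rightarrow> nat set set \<Rightarrow> (nat \<Rightarrow> symbol) topology" where
  "blur_topology X V = topology_generated_by
     ({cylinder X V w | w. w \<in> language X} \<union>
      {blur_cylinder X V w B S | w B S. w \<in> language X \<and> B \<in> V \<and> S \<subseteq> B \<and> finite S})"


section \<open>Borel probabilities on a topological space\<close>

definition borel_of :: "'a topology \<Rightarrow> 'a measure" where
  "borel_of T = sigma (topspace T) {U. openin T U}"

definition borel_probs :: "'a topology \<Rightarrow> 'a measure set" where
  "borel_probs T = {M. sets M = sets (borel_of T) \<and> prob_space M}"

text \<open>The coarsest topology for which \<open>M \<mapsto> \<integral> f dM\<close> is continuous for every bounded
  continuous \<open>f\<close>.\<close>

definition weak_star :: "'a topology \<Rightarrow> 'a measure topology" where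
  "weak_star T = topology_generated_by
     {{M \<in> borel_probs T. (\<integral>x. f x \<partial>M) \<in> U} | (f :: 'a \<Rightarrow> real) U.
        continuous_map T euclideanreal f \<and> bounded (f ` topspace T) \<and> open U}"

definition invariant_probs :: "'a topology \<Rightarrow> ('a \<Rightarrow> 'a) \<Rightarrow> 'a measure set" where
  "invariant_probs T g =
     {M \<in> borel_probs T. \<forall>A\<in>sets M. measure M (g -` A \<inter> space M) = measure M A}"

definition ergodic_probs :: "'a topology \<Rightarrow> ('a \<Rightarrow> 'a) \<Rightarrow> 'a measure set" where
  "ergodic_probs T g =
     {M \<in> invariant_probs T g.
        \<forall>A\<in>sets M. g -` A \<inter> space M = A \<longrightarrow> measure M A = 0 \<or> measure M A = 1}"

definition periodic_orbit_probs :: "'a topology \<Rightarrow> ('a \<Rightarrow> 'a) \<Rightarrow> 'a measure set" where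
  "periodic_orbit_probs T g =
     {M \<in> ergodic_probs T g.
        \<exists>x\<in>topspace T. \<exists>p\<ge>1. (g ^^ p) x = x \<and> measure M {(g ^^ i) x | i. i < p} = 1}"

end

theory Submission
  imports Defs
begin

text \<open>
Write \<open>\<Omega>\<close> for the blur shift. It is compact, and its generalized cylinders are clopen and form a
countable base. On such a space the set of all Borel probabilities is weak* compact
(\<open>compactin_borel_probs\<close>): probabilities correspond to finitely additive contents on the clopen
algebra, these form a closed subset of a power of \<open>[0, 1]\<close>, and integrals of continuous functions
depend continuously on the content. It remains to see that the invariant probabilities are closed.

This is not automatic, because the shift is discontinuous at the constant boundary points: letters
\<open>a\<close> that tend to infinity inside a blurred set \<open>B\<close> converge to \<open>B\<close>, while whatever follows them
may stay put. For a nonempty word \<open>w\<close> with first letter \<open>c\<close>, the preimage of the cylinder of \<open>w\<close> is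
the union over all letters \<open>a\<close> of the cylinders of \<open>a w\<close>, and in the limit mass could be lost from
the part \<open>a > N\<close>. The finite cyclic predecessor assumption prevents this. For fixed \<open>k\<close> and large
\<open>N\<close>, a letter \<open>a > N\<close> that can precede \<open>c\<close> cannot be reached from \<open>c\<close> within \<open>k\<close> steps, so the event
``a letter greater than \<open>N\<close> followed by \<open>c\<close>'' has \<open>k\<close> disjoint preimages and probability
at most \<open>1 / k\<close> for every invariant probability (\<open>large_before_measure_le\<close>). So the union
over \<open>a \<le> N\<close>, a clopen set, has the same measure as the cylinder of \<open>w\<close> up to an error of \<open>1 / k\<close>,
and this relation between measures of clopen sets passes to weak* limits.

Conversely, these estimates imply invariance (\<open>invariant_probs_eq\<close>). They give invariance on the
cylinders of nonempty words. This already forces boundary points of positive length to be null, the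
constant boundary points are fixed by the shift, and together with cylinders these points generate the
Borel sets.
\<close>

section \<open>Probabilities on compact spaces with a countable clopen base\<close>

lemma sets_borel_of: "sets (borel_of T) = sigma_sets (topspace T) {U. openin T U}"
  unfolding borel_of_def by (rule sets_measure_of) (auto dest: openin_subset)

lemma space_borel_of: "space (borel_of T) = topspace T"
  unfolding borel_of_def by (simp add: space_measure_of_conv)

lemma borel_probsD:
  assumes "M \<in> borel_probs T"
  shows "prob_space M" "sets M = sets (borel_of T)" "space M = topspace T"
  using assms sets_eq_imp_space_eq[of M "borel_of T"]
  by (auto simp: borel_probs_def space_borel_of)

lemma openin_in_sets_borel_prob:
  assumes "M \<in> borel_probs T" "openin T U"
  shows "U \<in> sets M"
  using assms by (auto simp: borel_probsD(2) sets_borel_of)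

lemma topspace_weak_star [simp]: "topspace (weak_star T) = borel_probs T"
proof -
  let ?S = "{{M \<in> borel_probs T. (\<integral>x. f x \<partial>M) \<in> U} | (f :: 'a \<Rightarrow> real) U.
        continuous_map T euclideanreal f \<and> bounded (f ` topspace T) \<and> open U}"
  have "bounded ((\<lambda>x. 0::real) ` topspace T)"
    by (rule boundedI[of _ 0]) auto
  then have "{M \<in> borel_probs T. (\<integral>x. (0::real) \<partial>M) \<in> UNIV} \<in> ?S"
    by (intro CollectI exI[of _ "\<lambda>x. 0::real"] exI[of _ UNIV] conjI refl) simp_all
  then have "borel_probs T \<subseteq> \<Union>?S" by (intro Union_upper) simp
  moreover have "\<Union>?S \<subseteq> borel_probs T" by blast
  ultimately show ?thesis
    unfolding weak_star_def topology_generated_by_topspace by (rule equalityI[rotated])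
qed

lemma continuous_map_borel_measurable:
  fixes f :: "'a \<Rightarrow> real"
  assumes "M \<in> borel_probs T" "continuous_map T euclideanreal f"
  shows "f \<in> borel_measurable M"
proof (rule borel_measurableI)
  fix S :: "real set" assume "open S"
  then have "openin T {x \<in> topspace T. f x \<in> S}"
    using assms(2) by (auto simp: continuous_map_def)
  moreover have "f -` S \<inter> space M = {x \<in> topspace T. f x \<in> S}"
    using borel_probsD(3)[OF assms(1)] by auto
  ultimately show "f -` S \<inter> space M \<in> sets M"
    using openin_in_sets_borel_prob[OF assms(1)] by simp
qed

lemma continuous_map_indicator_clopen:
  assumes "openin T C" "closedin T C"
  shows "continuous_map T euclideanreal (indicator C)"
proof -
  have "{x \<in> topspace T. indicator C x \<in> U} =
        (if (1::real) \<in> U then C else {}) \<union> (if 0 \<in> U then topspace T - C else {})" for U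
    using openin_subset[OF assms(1)] by (auto simp: indicator_def)
  then show ?thesis
    using assms by (auto simp: continuous_map_def openin_Un openin_diff)
qed

lemma closedin_weak_star_integral:
  fixes f :: "'a \<Rightarrow> real"
  assumes "continuous_map T euclideanreal f" "bounded (f ` topspace T)" "closed F"
  shows "closedin (weak_star T) {M \<in> borel_probs T. (\<integral>x. f x \<partial>M) \<in> F}"
proof -
  have "openin (weak_star T) {M \<in> borel_probs T. (\<integral>x. f x \<partial>M) \<in> - F}"
    unfolding weak_star_def using assms
    by (intro topology_generated_by_Basis) (auto simp: open_Compl intro!: exI[of _ f] exI[of _ "-F"])
  moreover have "topspace (weak_star T) - {M \<in> borel_probs T. (\<integral>x. f x \<partial>M) \<in> F}
      = {M \<in> borel_probs T. (\<integral>x. f x \<partial>M) \<in> - F}" by auto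
  ultimately show ?thesis by (auto simp: closedin_def)
qed

lemma closedin_weak_star_measure_diff_le:
  assumes "openin T A" "closedin T A" "openin T B" "closedin T B"
  shows "closedin (weak_star T) {M \<in> borel_probs T. \<bar>measure M A - measure M B\<bar> \<le> \<epsilon>}"
proof -
  let ?f = "\<lambda>x. indicator A x - indicator B x :: real"
  have "(\<integral>x. ?f x \<partial>M) = measure M A - measure M B" if M: "M \<in> borel_probs T" for M
  proof -
    interpret prob_space M using borel_probsD(1)[OF M] .
    show ?thesis
      using openin_in_sets_borel_prob[OF M] assms sets.sets_into_space
      by (subst Bochner_Integration.integral_diff) (auto simp: Int_absorb2 less_top[symmetric])
  qed
  then have "{M \<in> borel_probs T. \<bar>measure M A - measure M B\<bar> \<le> \<epsilon>} =
      {M \<in> borel_probs T. (\<integral>x. ?f x \<partial>M) \<in> {-\<epsilon>..\<epsilon>}}" by auto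
  also have "closedin (weak_star T) \<dots>"
    using assms
    by (intro closedin_weak_star_integral continuous_map_diff continuous_map_indicator_clopen
        boundedI[of _ 1]) (auto simp: indicator_def)
  finally show ?thesis .
qed

text \<open>On a compact space with a base of clopen sets, a Borel probability is the same thing as a finitely
additive content of total mass 1 on the clopen sets: countable additivity comes for free, because a
decreasing sequence of clopen sets with empty intersection is eventually empty. This replaces the Riesz
representation theorem in the usual proof that the Borel probabilities form a weak* compact set.\<close>

locale compact_clopen_base =
  fixes T :: "'a topology" and \<B> :: "'a set set"
  assumes compact: "compact_space T"
    and countable_base: "countable \<B>"
    and clopen_base: "\<And>C. C \<in> \<B> \<Longrightarrow> openin T C \<and> closedin T C"
    and base: "\<And>U x. openin T U \<Longrightarrow> x \<in> U \<Longrightarrow> \<exists>C\<in>\<B>. x \<in> C \<and> C \<subseteq> U"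
begin

definition clopens :: "'a set set" where
  "clopens = {C. openin T C \<and> closedin T C}"

lemma clopens_subset: "C \<in> clopens \<Longrightarrow> C \<subseteq> topspace T"
  by (auto simp: clopens_def dest: openin_subset)

lemma algebra_clopens: "algebra (topspace T) clopens"
  unfolding algebra_iff_Un clopens_def by (auto dest: openin_subset)

lemma sets_borel_of_base: "sets (borel_of T) = sigma_sets (topspace T) \<B>"
  unfolding sets_borel_of
proof (rule sigma_sets_eqI)
  fix U assume "U \<in> {U. openin T U}"
  then have U: "U = \<Union>{C\<in>\<B>. C \<subseteq> U}" using base by blast
  have "\<Union>{C\<in>\<B>. C \<subseteq> U} \<in> sigma_sets (topspace T) \<B>"
    by (rule sigma_sets_UNION)
       (auto intro: countable_subset[OF _ countable_base])
  then show "U \<in> sigma_sets (topspace T) \<B>" using U by simp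
qed (use clopen_base in auto)

lemma sets_borel_of_clopens: "sets (borel_of T) = sigma_sets (topspace T) clopens"
proof -
  have "\<B> \<subseteq> clopens" using clopen_base by (auto simp: clopens_def)
  then have "sigma_sets (topspace T) \<B> \<subseteq> sigma_sets (topspace T) clopens"
    by (rule sigma_sets_mono')
  moreover have "sigma_sets (topspace T) clopens \<subseteq> sigma_sets (topspace T) {U. openin T U}"
    by (rule sigma_sets_mono') (auto simp: clopens_def)
  ultimately show ?thesis using sets_borel_of_base sets_borel_of[of T] by blast
qed

text \<open>A continuous function is uniformly close to one that is constant on the pieces of a finite clopen
partition, so weak* convergence amounts to convergence on every clopen set.\<close>

lemma clopen_partition_small_oscillation:
  fixes f :: "'a \<Rightarrow> real"
  assumes f: "continuous_map T euclideanreal f" and e: "e > 0"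
  obtains n :: nat and D c where
    "\<And>i. i < n \<Longrightarrow> D i \<in> clopens" "disjoint_family_on D {..<n}"
    "(\<Union>i<n. D i) = topspace T" "\<And>i x. i < n \<Longrightarrow> x \<in> D i \<Longrightarrow> \<bar>f x - c i\<bar> \<le> e"
proof -
  let ?\<U> = "{C \<in> \<B>. \<exists>y. \<forall>x\<in>C. \<bar>f x - y\<bar> \<le> e}"
  have "topspace T \<subseteq> \<Union>?\<U>"
  proof
    fix x assume x: "x \<in> topspace T"
    have "openin T {z \<in> topspace T. f z \<in> ball (f x) e}"
      using f by (auto simp: continuous_map_def)
    from base[OF this, of x] x e obtain C where
      "C \<in> \<B>" "x \<in> C" "C \<subseteq> {z \<in> topspace T. f z \<in> ball (f x) e}" by auto
    then show "x \<in> \<Union>?\<U>"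
      by (auto simp: dist_real_def abs_minus_commute intro!: exI[of _ C] exI[of _ "f x"] less_imp_le)
  qed
  then obtain \<F> where \<F>: "finite \<F>" "\<F> \<subseteq> ?\<U>" "topspace T \<subseteq> \<Union>\<F>"
    using compact clopen_base unfolding compact_space_alt by (metis (no_types, lifting) mem_Collect_eq)
  obtain l where l: "set l = \<F>" using finite_list[OF \<F>(1)] by blast
  define A where "A i = (if i < length l then l ! i else {})" for i
  have A: "A i \<in> clopens" for i
    using \<F>(2) l clopen_base by (auto simp: A_def clopens_def subset_iff)
  interpret algebra "topspace T" clopens by (rule algebra_clopens)
  have "\<exists>y. \<forall>x\<in>A i. \<bar>f x - y\<bar> \<le> e" for i
    using \<F>(2) l by (auto simp: A_def subset_iff)
  then obtain c where c: "\<And>i x. x \<in> A i \<Longrightarrow> \<bar>f x - c i\<bar> \<le> e" by metis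
  have "(\<Union>i<length l. A i) = topspace T"
  proof
    show "(\<Union>i<length l. A i) \<subseteq> topspace T" using A clopens_subset by blast
    show "topspace T \<subseteq> (\<Union>i<length l. A i)"
    proof
      fix x assume "x \<in> topspace T"
      then obtain C where "C \<in> set l" "x \<in> C" using \<F>(3) l by auto
      then show "x \<in> (\<Union>i<length l. A i)" by (auto simp: in_set_conv_nth A_def)
    qed
  qed
  moreover have "(\<Union>i<length l. disjointed A i) = (\<Union>i<length l. A i)"
    using finite_UN_disjointed_eq[of A "length l"] by (simp add: atLeast0LessThan)
  moreover have "disjointed A i \<in> clopens" for i
    using range_disjointed_sets[of A] A by auto
  moreover have "disjoint_family_on (disjointed A) {..<length l}"
    using disjoint_family_disjointed[of A] by (rule disjoint_family_on_mono[rotated]) simp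
  ultimately show thesis
    using c subsetD[OF disjointed_subset[of A]]
    by (intro that[of "length l" "disjointed A" c]) simp_all
qed

lemma bounded_continuous_image:
  assumes "continuous_map T euclideanreal f"
  shows "bounded (f ` topspace T)"
  using image_compactin[OF _ assms, of "topspace T"] compact
  by (simp add: compact_space_def compact_imp_bounded)

lemma integral_near_simple:
  fixes f :: "'a \<Rightarrow> real" and n :: nat
  assumes M: "M \<in> borel_probs T" and f: "continuous_map T euclideanreal f"
    and D: "\<And>i. i < n \<Longrightarrow> D i \<in> clopens" "disjoint_family_on D {..<n}"
      "(\<Union>i<n. D i) = topspace T"
    and osc: "\<And>i x. i < n \<Longrightarrow> x \<in> D i \<Longrightarrow> \<bar>f x - c i\<bar> \<le> e"
  shows "\<bar>(\<integral>x. f x \<partial>M) - (\<Sum>i<n. c i * measure M (D i))\<bar> \<le> e"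
proof -
  interpret prob_space M using borel_probsD(1)[OF M] .
  have sp: "space M = topspace T" using borel_probsD(3)[OF M] .
  let ?g = "\<lambda>x. \<Sum>i<n. c i * indicator (D i) x"
  have Ds: "D i \<in> sets M" if "i < n" for i
    using D(1)[OF that] openin_in_sets_borel_prob[OF M] by (auto simp: clopens_def)
  obtain K where K: "\<And>x. x \<in> topspace T \<Longrightarrow> \<bar>f x\<bar> \<le> K"
    using bounded_continuous_image[OF f] by (auto simp: bounded_iff)
  have intf: "integrable M f"
    using K sp by (intro integrable_const_bound[of _ K] continuous_map_borel_measurable[OF M f])
       (auto intro!: AE_I2)
  have intg: "integrable M ?g"
    using Ds
    by (intro Bochner_Integration.integrable_sum integrable_mult_right)
       (simp add: less_top[symmetric])
  have intgv: "(\<integral>x. ?g x \<partial>M) = (\<Sum>i<n. c i * measure M (D i))"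
    using Ds sets.sets_into_space
    by (subst Bochner_Integration.integral_sum)
       (auto simp: less_top[symmetric] Int_absorb2 intro!: sum.cong)
  have "\<bar>f x - ?g x\<bar> \<le> e" if x: "x \<in> space M" for x
  proof -
    obtain i where i: "i < n" "x \<in> D i" using x sp D(3) by auto
    have "?g x = (\<Sum>j<n. if j = i then c i else 0)"
      using i D(2) by (intro sum.cong) (auto simp: disjoint_family_on_def indicator_def)
    also have "\<dots> = c i" using i(1) by (simp add: sum.delta)
    finally have "?g x = c i" .
    then show ?thesis using osc i by simp
  qed
  then have "\<bar>\<integral>x. f x - ?g x \<partial>M\<bar> \<le> e"
    using intf intg sp prob_space
    by (intro order_trans[OF integral_abs_bound] integral_le_const) (auto intro!: AE_I2)
  then show ?thesis using intf intg intgv by simp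
qed

text \<open>A content carries a value on every set, not just on clopen ones, so that the contents form a subset
of a full power of \<open>[0, 1]\<close> and Tychonoff's theorem applies; values off the clopen algebra are
arbitrary.\<close>

definition contents :: "('a set \<Rightarrow> real) set" where
  "contents = {m. (\<forall>A. m A \<in> {0..1}) \<and> m (topspace T) = 1 \<and>
     (\<forall>A\<in>clopens. \<forall>B\<in>clopens. A \<inter> B = {} \<longrightarrow> m (A \<union> B) = m A + m B)}"

lemma compact_contents: "compact contents"
proof -
  have ev: "continuous_on UNIV (\<lambda>m::'a set \<Rightarrow> real. m A)" for A
    by (rule continuous_on_product_coordinates)
  have "compactin euclidean (Pi\<^sub>E UNIV (\<lambda>A::'a set. {0..1::real}))"
    unfolding euclidean_product_topology[symmetric] by (simp add: compactin_PiE)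
  then have "compact {m::'a set \<Rightarrow> real. \<forall>A. m A \<in> {0..1}}"
    by (simp add: PiE_UNIV_domain Pi_def)
  moreover have "closed {m::'a set \<Rightarrow> real. m (topspace T) = 1}"
    by (intro closed_Collect_eq ev continuous_on_const)
  moreover have "closed {m::'a set \<Rightarrow> real.
      \<forall>A\<in>clopens. \<forall>B\<in>clopens. A \<inter> B = {} \<longrightarrow> m (A \<union> B) = m A + m B}"
    unfolding Ball_def
    by (intro closed_Collect_all closed_Collect_imp closed_Collect_eq ev continuous_on_add) auto
  ultimately have "compact ({m::'a set \<Rightarrow> real. \<forall>A. m A \<in> {0..1}} \<inter>
     ({m. m (topspace T) = 1} \<inter>
     {m. \<forall>A\<in>clopens. \<forall>B\<in>clopens. A \<inter> B = {} \<longrightarrow> m (A \<union> B) = m A + m B}))"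
    by (intro compact_Int_closed closed_Int)
  moreover have "contents = {m::'a set \<Rightarrow> real. \<forall>A. m A \<in> {0..1}} \<inter>
     ({m. m (topspace T) = 1} \<inter>
     {m. \<forall>A\<in>clopens. \<forall>B\<in>clopens. A \<inter> B = {} \<longrightarrow> m (A \<union> B) = m A + m B})"
    unfolding contents_def by blast
  ultimately show ?thesis by simp
qed

text \<open>Caratheodory's extension theorem; its continuity hypothesis at the empty set is the nested-set form of
compactness.\<close>

lemma content_extends:
  assumes m: "m \<in> contents"
  shows "\<exists>M\<in>borel_probs T. \<forall>C\<in>clopens. measure M C = m C"
proof -
  interpret algebra "topspace T" clopens by (rule algebra_clopens)
  have m0: "m A \<ge> 0" for A using m by (simp add: contents_def)
  have add: "m (A \<union> B) = m A + m B" if "A \<in> clopens" "B \<in> clopens" "A \<inter> B = {}" for A B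
    using m that by (simp add: contents_def)
  have "m {} = 0" using add[of "{}" "{}"] by simp
  have "\<exists>\<mu>. (\<forall>s\<in>clopens. \<mu> s = ennreal (m s)) \<and>
      measure_space (topspace T) (sigma_sets (topspace T) clopens) \<mu>"
  proof (rule caratheodory_empty_continuous)
    show "positive clopens (\<lambda>s. ennreal (m s))" using \<open>m {} = 0\<close> by (simp add: positive_def)
    show "additive clopens (\<lambda>s. ennreal (m s))" using add m0 by (simp add: additive_def ennreal_plus)
    fix A :: "nat \<Rightarrow> 'a set"
    assume A: "range A \<subseteq> clopens" "decseq A" "(\<Inter>i. A i) = {}"
    have "\<exists>n. A n = {}"
    proof (rule ccontr)
      assume ne: "\<nexists>n. A n = {}"
      have "\<Inter>(range A) \<noteq> {}"
      proof (rule compact_space_imp_nest[OF compact])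
        show "closedin T (A n)" for n using A(1) by (auto simp: clopens_def)
        show "A n \<noteq> {}" for n using ne by blast
        show "decseq A" by (rule A(2))
      qed
      then show False using A(3) by simp
    qed
    then obtain n where "A n = {}" by blast
    then have "A i = {}" if "i \<ge> n" for i using decseqD[OF A(2) that] by simp
    then have "\<forall>\<^sub>F i in sequentially. ennreal (m (A i)) = 0"
      using \<open>m {} = 0\<close> by (auto simp: eventually_sequentially intro!: exI[of _ n])
    then show "(\<lambda>i. ennreal (m (A i))) \<longlonglongrightarrow> 0" by (rule tendsto_eventually)
  qed simp
  then obtain \<mu> where \<mu>: "\<And>s. s \<in> clopens \<Longrightarrow> \<mu> s = ennreal (m s)"
    "measure_space (topspace T) (sigma_sets (topspace T) clopens) \<mu>" by blast
  define M where "M = measure_of (topspace T) (sigma_sets (topspace T) clopens) \<mu>"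
  have sub: "clopens \<subseteq> Pow (topspace T)" using clopens_subset by blast
  have sets: "sets M = sigma_sets (topspace T) clopens"
    unfolding M_def using sigma_sets_into_sp[OF sub]
    by (subst sets_measure_of) (auto simp: sigma_sets_sigma_sets_eq[OF sub])
  have em: "emeasure M A = \<mu> A" if "A \<in> sigma_sets (topspace T) clopens" for A
    unfolding M_def
    using \<mu>(2) that by (intro emeasure_measure_of_sigma) (simp_all add: measure_space_def)
  have meas: "measure M C = m C" if "C \<in> clopens" for C
    unfolding measure_def em[OF sigma_sets.Basic[OF that]] \<mu>(1)[OF that] using m0 by simp
  have sp: "space M = topspace T" by (simp add: M_def space_measure_of_conv)
  have "emeasure M (space M) = 1"
    using em[of "topspace T"] \<mu>(1)[of "topspace T"] m top sp
    by (simp add: contents_def sigma_sets_top)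
  then have "prob_space M" by (rule prob_spaceI)
  then have "M \<in> borel_probs T" using sets by (simp add: borel_probs_def sets_borel_of_clopens)
  then show ?thesis using meas by blast
qed

text \<open>The extension map from contents to probabilities is onto, and it is continuous because integrals
are uniform limits of finite linear combinations of values on clopen sets. Hence the probabilities are
a continuous image of a compact set.\<close>

lemma compactin_borel_probs: "compactin (weak_star T) (borel_probs T)"
proof -
  interpret algebra "topspace T" clopens by (rule algebra_clopens)
  obtain \<Phi> where \<Phi>: "\<And>m. m \<in> contents \<Longrightarrow> \<Phi> m \<in> borel_probs T"
      "\<And>m C. m \<in> contents \<Longrightarrow> C \<in> clopens \<Longrightarrow> measure (\<Phi> m) C = m C"
    using content_extends by metis
  have "continuous_map (top_of_set contents) (weak_star T) \<Phi>"
    unfolding weak_star_def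
  proof (rule continuous_on_generated_topo)
    show "\<Phi> ` topspace (top_of_set contents) \<subseteq> \<Union> {{M \<in> borel_probs T. (\<integral>x. f x \<partial>M) \<in> U} |
        (f :: 'a \<Rightarrow> real) U.
        continuous_map T euclideanreal f \<and> bounded (f ` topspace T) \<and> open U}"
      using \<Phi>(1) topspace_weak_star[of T] unfolding weak_star_def topology_generated_by_topspace
      by auto
    fix \<W> assume "\<W> \<in> {{M \<in> borel_probs T. (\<integral>x. f x \<partial>M) \<in> U} | (f :: 'a \<Rightarrow> real) U.
        continuous_map T euclideanreal f \<and> bounded (f ` topspace T) \<and> open U}"
    then obtain f :: "'a \<Rightarrow> real" and U where W: "\<W> = {M \<in> borel_probs T. (\<integral>x. f x \<partial>M) \<in> U}"
      and f: "continuous_map T euclideanreal f" and U: "open U" by blast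
    have "continuous_on contents (\<lambda>m. \<integral>x. f x \<partial>\<Phi> m)"
      unfolding continuous_on_def tendsto_iff
    proof (intro ballI allI impI)
      fix m0 and e :: real assume m0: "m0 \<in> contents" and e: "e > 0"
      obtain n D c where D: "\<And>i. i < n \<Longrightarrow> D i \<in> clopens" "disjoint_family_on D {..<n::nat}"
          "(\<Union>i<n. D i) = topspace T" "\<And>i x. i < n \<Longrightarrow> x \<in> D i \<Longrightarrow> \<bar>f x - c i\<bar> \<le> e / 3"
        using clopen_partition_small_oscillation[OF f, of "e / 3"] e by auto
      define S where "S m = (\<Sum>i<n. c i * m (D i))" for m :: "'a set \<Rightarrow> real"
      have near: "\<bar>(\<integral>x. f x \<partial>\<Phi> m) - S m\<bar> \<le> e / 3" if "m \<in> contents" for m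
        using integral_near_simple[OF \<Phi>(1)[OF that] f D] \<Phi>(2)[OF that] D(1)
        by (simp add: S_def)
      have "continuous_on contents S"
        unfolding S_def
        by (intro continuous_on_sum continuous_on_mult continuous_on_const
            continuous_on_subset[OF continuous_on_product_coordinates]) auto
      then have "\<forall>\<^sub>F m in at m0 within contents. dist (S m) (S m0) < e / 3"
        using m0 e unfolding continuous_on_def tendsto_iff by (metis zero_less_divide_iff zero_less_numeral)
      then show "\<forall>\<^sub>F m in at m0 within contents.
          dist (\<integral>x. f x \<partial>\<Phi> m) (\<integral>x. f x \<partial>\<Phi> m0) < e"
        unfolding eventually_at_topological
      proof (elim exE conjE, intro exI conjI ballI impI)
        fix N m assume N: "\<forall>m\<in>N. m \<noteq> m0 \<longrightarrow> m \<in> contents \<longrightarrow> dist (S m) (S m0) < e / 3"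
          and m: "m \<in> N" "m \<noteq> m0" "m \<in> contents"
        show "dist (\<integral>x. f x \<partial>\<Phi> m) (\<integral>x. f x \<partial>\<Phi> m0) < e"
          using near[OF m0] near[OF m(3)] N[rule_format, OF m] unfolding dist_real_def by argo
      qed
    qed
    then have "openin (top_of_set contents) (contents \<inter> (\<lambda>m. \<integral>x. f x \<partial>\<Phi> m) -` U)"
      using U by (rule continuous_openin_preimage_gen)
    moreover have "\<Phi> -` \<W> \<inter> topspace (top_of_set contents) =
        contents \<inter> (\<lambda>m. \<integral>x. f x \<partial>\<Phi> m) -` U"
      using \<Phi>(1) W by auto
    ultimately show "openin (top_of_set contents) (\<Phi> -` \<W> \<inter> topspace (top_of_set contents))"
      by simp
  qed
  moreover have "compactin (top_of_set contents) contents"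
    using compact_contents by (simp add: compactin_subtopology)
  ultimately have "compactin (weak_star T) (\<Phi> ` contents)" by (rule image_compactin[rotated])
  moreover have "\<Phi> ` contents = borel_probs T"
  proof
    show "\<Phi> ` contents \<subseteq> borel_probs T" using \<Phi>(1) by blast
    show "borel_probs T \<subseteq> \<Phi> ` contents"
    proof
      fix M assume M: "M \<in> borel_probs T"
      interpret prob_space M using borel_probsD(1)[OF M] .
      have cs: "C \<in> sets M" if "C \<in> clopens" for C
        using openin_in_sets_borel_prob[OF M] that by (simp add: clopens_def)
      have m: "measure M \<in> contents"
        using cs prob_space borel_probsD(3)[OF M]
        by (auto simp: contents_def finite_measure_Union)
      have "M = \<Phi> (measure M)"
      proof (rule measure_eqI_generator_eq)
        show "Int_stable clopens" by (auto simp: Int_stable_def)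
        show "clopens \<subseteq> Pow (topspace T)" using clopens_subset by blast
        show "emeasure M C = emeasure (\<Phi> (measure M)) C" if "C \<in> clopens" for C
        proof -
          interpret \<Phi>: prob_space "\<Phi> (measure M)" using borel_probsD(1)[OF \<Phi>(1)[OF m]] .
          show ?thesis
            using \<Phi>(2)[OF m that] by (simp add: emeasure_eq_measure \<Phi>.emeasure_eq_measure)
        qed
        show "sets M = sigma_sets (topspace T) clopens"
          "sets (\<Phi> (measure M)) = sigma_sets (topspace T) clopens"
          using borel_probsD(2)[OF M] borel_probsD(2)[OF \<Phi>(1)[OF m]] sets_borel_of_clopens by auto
        show "range (\<lambda>i::nat. topspace T) \<subseteq> clopens" by (simp add: top)
        show "(\<Union>i::nat. topspace T) = topspace T" by simp
        show "emeasure M (topspace T) \<noteq> \<infinity>" by simp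
      qed
      then show "M \<in> \<Phi> ` contents" using m by blast
    qed
  qed
  ultimately show ?thesis by simp
qed

end

section \<open>Blur shifts are compact with a countable clopen base\<close>

lemma language_iff: "w \<in> language X \<longleftrightarrow> w = [] \<or> (\<exists>x\<in>X. w = map x [0..<length w])"
  by (force simp: language_def words_def split: if_splits)

lemma words_iff: "w \<in> words X k \<longleftrightarrow> w \<in> language X \<and> length w = k"
  unfolding language_iff by (auto simp: words_def split: if_splits)

lemma letters_iff: "a \<in> letters X \<longleftrightarrow> [a] \<in> language X"
  by (auto simp: letters_def words_iff)

lemma language_prefix:
  assumes "u @ v \<in> language X"
  shows "u \<in> language X"
proof -
  have "map x [0..<length u] = u" if "u @ v = map x [0..<length (u @ v)]" for x
    using arg_cong[OF that, of "take (length u)"] by (simp add: take_map)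
  then show ?thesis using assms unfolding language_iff by (metis append_is_Nil_conv)
qed

lemma followers_1: "followers X (Suc 0) w = {b \<in> letters X. w @ [b] \<in> language X}"
  by (auto simp: followers_def words_def)

locale blur_shift =
  fixes X :: "(nat \<Rightarrow> nat) set" and V :: "nat set set"
  assumes shift: "shift_space X" and resolution: "finite_resolution X V"
begin

abbreviation \<Omega> :: "(nat \<Rightarrow> symbol) set" where "\<Omega> \<equiv> blur_space X V"
abbreviation T :: "(nat \<Rightarrow> symbol) topology" where "T \<equiv> blur_topology X V"
abbreviation Z :: "nat list \<Rightarrow> (nat \<Rightarrow> symbol) set" where "Z \<equiv> cylinder X V"

lemma language_suffix:
  assumes "u @ v \<in> language X"
  shows "v \<in> language X"
  using assms
proof (induction u)
  case (Cons a u)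
  have "u @ v \<in> language X"
  proof (cases "u @ v = []")
    case False
    from Cons.prems obtain x where x: "x \<in> X" "a # (u @ v) = map x [0..<Suc (length (u @ v))]"
      by (auto simp: language_iff)
    have "u @ v = map (left_shift x) [0..<length (u @ v)]"
      using x(2) by (simp add: map_upt_Suc left_shift_def del: upt_Suc)
    moreover have "left_shift x \<in> X" using x(1) shift by (auto simp: shift_space_def)
    ultimately show ?thesis unfolding language_iff by blast
  qed (simp add: language_iff)
  then show ?case by (rule Cons.IH)
qed simp

lemma language_factor: "u @ v @ w \<in> language X \<Longrightarrow> v \<in> language X"
  using language_prefix language_suffix by blast

lemma language_last_letter: "u @ [a] \<in> language X \<Longrightarrow> a \<in> letters X"
  using language_suffix by (simp add: letters_iff)

lemma finite_V: "finite V"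
  and V_finite_Int: "B \<in> V \<Longrightarrow> C \<in> V \<Longrightarrow> B \<noteq> C \<Longrightarrow> finite (B \<inter> C)"
  and finite_uncovered: "finite (letters X - \<Union>V)"
  using resolution by (auto simp: finite_resolution_def)

lemma blur_space_cases:
  assumes "x \<in> \<Omega>"
  obtains (point) y where "y \<in> X" "x = (\<lambda>i. Letter (y i))"
  | (boundary) w B where "w \<in> language X" "B \<in> V" "infinite (followers X 1 w \<inter> B)"
      "x = boundary_point w B"
  using assms by (auto simp: blur_space_def boundary_def)

lemma boundary_point_in_blur_space:
  "w \<in> language X \<Longrightarrow> B \<in> V \<Longrightarrow> infinite (followers X 1 w \<inter> B) \<Longrightarrow> boundary_point w B \<in> \<Omega>"
  by (auto simp: blur_space_def boundary_def)

lemma prefix_in_language: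
  assumes "x \<in> \<Omega>" "\<And>i. i < length w \<Longrightarrow> x i = Letter (w ! i)"
  shows "w \<in> language X"
  using assms(1)
proof (cases rule: blur_space_cases)
  case (point y)
  then have "w = map y [0..<length w]" using assms(2) by (auto intro: nth_equalityI)
  then show ?thesis using point(1) by (auto simp: language_iff)
next
  case (boundary u B)
  have len: "length w \<le> length u"
    using assms(2)[of "length u"] boundary(4) by (force simp: boundary_point_def)
  have "w = take (length w) u"
  proof (rule nth_equalityI)
    fix i assume i: "i < length w"
    then have "Letter (u ! i) = Letter (w ! i)"
      using assms(2)[OF i] boundary(4) len by (simp add: boundary_point_def)
    then show "w ! i = take (length w) u ! i" using i by simp
  qed (use len in simp)
  moreover have "take (length w) u \<in> language X"
    using boundary(1) language_prefix[of "take (length w) u" "drop (length w) u" X]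
    by (simp only: append_take_drop_id)
  ultimately show ?thesis by simp
qed

lemma cylinder_nonempty_language: "x \<in> Z w \<Longrightarrow> w \<in> language X"
  by (rule prefix_in_language[of x]) (simp_all add: cylinder_def)

lemma blur_point_eq:
  assumes "x \<in> \<Omega>" "\<And>i. i < length w \<Longrightarrow> x i = Letter (w ! i)" "x (length w) = Blur B"
  shows "x = boundary_point w B" "w \<in> language X" "B \<in> V" "infinite (followers X 1 w \<inter> B)"
proof -
  have "x = boundary_point w B \<and> w \<in> language X \<and> B \<in> V \<and> infinite (followers X 1 w \<inter> B)"
    using assms(1)
  proof (cases rule: blur_space_cases)
    case (boundary u C)
    have "\<not> length w < length u" using assms(3) boundary(4) by (auto simp: boundary_point_def)
    moreover have "\<not> length u < length w"
      using assms(2)[of "length u"] boundary(4) by (auto simp: boundary_point_def)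
    ultimately have len: "length u = length w" by simp
    have "u = w"
    proof (rule nth_equalityI)
      fix i assume "i < length u"
      then show "u ! i = w ! i"
        using assms(2)[of i] boundary(4) len by (simp add: boundary_point_def)
    qed (rule len)
    moreover have "C = B" using assms(3) boundary(4) len by (simp add: boundary_point_def)
    ultimately show ?thesis using boundary by simp
  qed (use assms(3) in simp)
  then show "x = boundary_point w B" "w \<in> language X" "B \<in> V"
    "infinite (followers X 1 w \<inter> B)" by auto
qed

lemma cylinder_snoc:
  "x \<in> Z (w @ [a]) \<longleftrightarrow> x \<in> Z w \<and> x (length w) = Letter a"
  by (auto simp: cylinder_def nth_append less_Suc_eq)

lemma cylinder_cases:
  assumes "x \<in> Z w"
  obtains (letter) a where "x \<in> Z (w @ [a])"
  | (blur) B where "x = boundary_point w B" "B \<in> V" "infinite (followers X 1 w \<inter> B)"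
proof (cases "x (length w)")
  case (Letter a)
  then show ?thesis using assms letter by (simp add: cylinder_snoc)
next
  case (Blur B)
  then show ?thesis using assms blur blur_point_eq[of x w B] by (auto simp: cylinder_def)
qed

lemma left_shift_blur_space:
  assumes "x \<in> \<Omega>"
  shows "left_shift x \<in> \<Omega>"
  using assms
proof (cases rule: blur_space_cases)
  case (point y)
  then have "left_shift y \<in> X" using shift by (auto simp: shift_space_def)
  moreover have "left_shift x = (\<lambda>i. Letter (left_shift y i))"
    using point by (simp add: left_shift_def)
  ultimately show ?thesis by (auto simp: blur_space_def)
next
  case (boundary w B)
  show ?thesis
  proof (cases w)
    case Nil
    then have "left_shift x = x" using boundary by (simp add: left_shift_def boundary_point_def)
    then show ?thesis using assms by simp
  next
    case (Cons a u)
    have "u \<in> language X" using boundary(1) Cons language_suffix[of "[a]" u] by simp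
    moreover have "followers X 1 w \<inter> B \<subseteq> followers X 1 u \<inter> B"
      using Cons language_suffix[of "[a]"] by (auto simp: followers_1)
    then have "infinite (followers X 1 u \<inter> B)" using boundary(3) infinite_super by blast
    moreover have "left_shift x = boundary_point u B"
      using Cons boundary by (auto simp: left_shift_def boundary_point_def)
    ultimately show ?thesis using boundary(2) boundary_point_in_blur_space by simp
  qed
qed

definition cylinders :: "(nat \<Rightarrow> symbol) set set" where
  "cylinders = {Z w | w. w \<in> language X} \<union>
      {blur_cylinder X V w B S | w B S. w \<in> language X \<and> B \<in> V \<and> S \<subseteq> B \<and> finite S}"

lemma blur_topology_cylinders: "T = topology_generated_by cylinders"
  by (simp add: blur_topology_def cylinders_def)

lemma topspace_blur: "topspace T = \<Omega>"
proof -
  have "\<Union>cylinders \<subseteq> \<Omega>" by (auto simp: cylinders_def blur_cylinder_def cylinder_def)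
  moreover have "\<Omega> = Z []" by (simp add: cylinder_def)
  moreover have "Z [] \<in> cylinders" by (auto simp: cylinders_def language_iff)
  ultimately show ?thesis unfolding blur_topology_cylinders topology_generated_by_topspace by blast
qed

lemma countable_cylinders: "countable cylinders"
proof -
  have "cylinders \<subseteq> range Z \<union> (\<lambda>(w, B, S). blur_cylinder X V w B S) `
      (UNIV \<times> V \<times> {S. finite S})"
  proof
    fix C assume "C \<in> cylinders"
    then consider w where "C = Z w"
      | w B S where "C = blur_cylinder X V w B S" "B \<in> V" "finite S"
      by (auto simp: cylinders_def)
    then show "C \<in> range Z \<union> (\<lambda>(w, B, S). blur_cylinder X V w B S) ` (UNIV \<times> V \<times> {S. finite S})"
    proof cases
      case 2
      then show ?thesis by (intro UnI2 image_eqI[of _ _ "(w, B, S)"]) simp_all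
    qed simp
  qed
  moreover have "countable \<dots>"
    using finite_V
    by (intro countable_Un countable_image countable_SIGMA countableI_type
        countable_Collect_finite countable_finite)
  ultimately show ?thesis by (rule countable_subset)
qed

lemma cylinder_in_cylinders: "x \<in> Z w \<Longrightarrow> Z w \<in> cylinders"
  using cylinder_nonempty_language by (auto simp: cylinders_def)

lemma blur_cylinder_in_cylinders:
  "w \<in> language X \<Longrightarrow> B \<in> V \<Longrightarrow> finite S \<Longrightarrow> S \<subseteq> B \<Longrightarrow> blur_cylinder X V w B S \<in> cylinders"
  by (auto simp: cylinders_def)

lemma in_cylinder_map: "x \<in> Z (map y [0..<k]) \<longleftrightarrow> x \<in> \<Omega> \<and> (\<forall>i<k. x i = Letter (y i))"
  by (auto simp: cylinder_def)

text \<open>Around each point, a finite intersection of generating sets contains a single generating set.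
Around points of the shift space it can be taken to be a plain cylinder; the next lemma treats the
boundary points.\<close>

lemma open_contains_cylinder:
  assumes "openin T U" "(\<lambda>i. Letter (y i)) \<in> U"
  shows "\<exists>k. Z (map y [0..<k]) \<subseteq> U"
proof -
  have "generate_topology_on cylinders U"
    using assms(1) unfolding blur_topology_cylinders by (rule openin_topology_generated_by)
  then show ?thesis using assms(2)
  proof induction
    case (Int a b)
    then obtain k l where "Z (map y [0..<k]) \<subseteq> a" "Z (map y [0..<l]) \<subseteq> b" by auto
    moreover have "Z (map y [0..<max k l]) \<subseteq> Z (map y [0..<k]) \<inter> Z (map y [0..<l])"
      by (auto simp: in_cylinder_map)
    ultimately show ?case by blast
  next
    case (UN K)
    then obtain a k where "a \<in> K" "Z (map y [0..<k]) \<subseteq> a" by blast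
    then show ?case by blast
  next
    case (Basis s)
    from Basis(1) obtain w where "s = Z w \<or> (\<exists>B S. s = blur_cylinder X V w B S)"
      by (auto simp: cylinders_def)
    then have "Z (map y [0..<Suc (length w)]) \<subseteq> s"
    proof (elim disjE exE)
      assume "s = Z w"
      then show ?thesis using Basis(2) by (auto simp: in_cylinder_map cylinder_def simp del: upt_Suc)
    next
      fix B S assume "s = blur_cylinder X V w B S"
      then show ?thesis using Basis(2)
        by (auto simp: in_cylinder_map cylinder_def blur_cylinder_def simp del: upt_Suc)
    qed
    then show ?case by blast
  qed simp
qed

lemma open_contains_blur_cylinder:
  assumes "openin T U" "boundary_point w B \<in> U"
  shows "\<exists>S. finite S \<and> S \<subseteq> B \<and> blur_cylinder X V w B S \<subseteq> U"
proof -
  have "generate_topology_on cylinders U"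
    using assms(1) unfolding blur_topology_cylinders by (rule openin_topology_generated_by)
  then show ?thesis using assms(2)
  proof induction
    case (Int a b)
    then obtain R S where "finite R" "R \<subseteq> B" "finite S" "S \<subseteq> B"
      "blur_cylinder X V w B R \<subseteq> a" "blur_cylinder X V w B S \<subseteq> b" by auto
    moreover have "blur_cylinder X V w B (R \<union> S) \<subseteq> blur_cylinder X V w B R \<inter> blur_cylinder X V w B S"
      by (auto simp: blur_cylinder_def)
    ultimately show ?case by (intro exI[of _ "R \<union> S"]) blast
  next
    case (UN K)
    then obtain a where a: "a \<in> K" "boundary_point w B \<in> a" by blast
    from UN.IH[OF a] obtain S where S: "finite S" "S \<subseteq> B" "blur_cylinder X V w B S \<subseteq> a"
      by (elim exE conjE)
    have "blur_cylinder X V w B S \<subseteq> \<Union>K" using S(3) Union_upper[OF a(1)] by (rule order_trans)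
    then show ?case using S(1,2) by (intro exI[of _ S] conjI)
  next
    case (Basis s)
    have sub: "blur_cylinder X V w B {} \<subseteq> Z u"
      if u: "length u \<le> length w" "\<And>i. i < length u \<Longrightarrow> u ! i = w ! i" for u
      using u by (auto simp: blur_cylinder_def cylinder_def)
    have pre: "length u \<le> length w \<and> (\<forall>i<length u. u ! i = w ! i)"
      if u: "boundary_point w B \<in> Z u" for u
    proof -
      have *: "boundary_point w B i = Letter (u ! i)" if "i < length u" for i
        using u that by (simp add: cylinder_def)
      have "length u \<le> length w"
        using *[of "length w"] by (force simp: boundary_point_def)
      then show ?thesis using * by (auto simp: boundary_point_def)
    qed
    consider u where "s = Z u" | u C S where "s = blur_cylinder X V u C S" "S \<subseteq> C" "finite S"
      using Basis(1) by (auto simp: cylinders_def)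
    then show ?case
    proof cases
      case 1
      then show ?thesis using sub[of u] pre[of u] Basis(2) by blast
    next
      case (2 u C S)
      have u: "length u \<le> length w" "\<And>i. i < length u \<Longrightarrow> u ! i = w ! i"
        using pre[of u] Basis(2) 2(1) by (auto simp: blur_cylinder_def)
      show ?thesis
      proof (cases "length u = length w")
        case True
        then have "u = w" using u(2) by (auto intro: nth_equalityI)
        then have "C = B" using Basis(2) 2(1) by (auto simp: blur_cylinder_def boundary_point_def)
        then show ?thesis using 2 \<open>u = w\<close> by blast
      next
        case False
        \<comment> \<open>If \<open>u\<close> is a proper prefix of \<open>w\<close>, then the letter of \<open>w\<close> after \<open>u\<close> is already in
            \<open>C - S\<close>, so membership in \<open>s\<close> is decided by the word \<open>w\<close>.\<close>
        then have "blur_cylinder X V w B {} \<subseteq> s"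
          using sub[OF u] u(1) Basis(2) 2(1)
          by (auto simp: blur_cylinder_def boundary_point_def cylinder_def)
        then show ?thesis by blast
      qed
    qed
  qed simp
qed

lemma in_own_blur_cylinder:
  "boundary_point w B \<in> \<Omega> \<Longrightarrow> boundary_point w B \<in> blur_cylinder X V w B S"
  by (auto simp: blur_cylinder_def cylinder_def boundary_point_def)

lemma cylinders_base:
  assumes "openin T U" "x \<in> U"
  shows "\<exists>C\<in>cylinders. x \<in> C \<and> C \<subseteq> U"
proof -
  have x: "x \<in> \<Omega>" using assms openin_subset topspace_blur by blast
  then show ?thesis
  proof (cases rule: blur_space_cases)
    case (point y)
    then obtain k where k: "Z (map y [0..<k]) \<subseteq> U" using open_contains_cylinder assms by blast
    have "x \<in> Z (map y [0..<k])" using x point by (simp add: in_cylinder_map)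
    then show ?thesis using k cylinder_in_cylinders by blast
  next
    case (boundary w B)
    obtain S where S: "finite S" "S \<subseteq> B" "blur_cylinder X V w B S \<subseteq> U"
      using open_contains_blur_cylinder[OF assms(1), of w B] assms(2) boundary(4) by auto
    have "blur_cylinder X V w B S \<in> cylinders"
      using boundary(1,2) S(1,2) by (rule blur_cylinder_in_cylinders)
    moreover have "x \<in> blur_cylinder X V w B S"
      using in_own_blur_cylinder x boundary(4) by simp
    ultimately show ?thesis using S(3) by blast
  qed
qed

text \<open>Consider the first coordinate \<open>i\<close> at which \<open>x\<close> leaves \<open>w\<close>. A different letter there is itself an
open condition; a blur symbol \<open>B\<close> is separated from the letter \<open>w ! i\<close> by removing that letter from \<open>B\<close>.\<close>

lemma separate_from_cylinder:
  assumes x: "x \<in> \<Omega>" "x \<notin> Z w"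
  shows "\<exists>C\<in>cylinders. x \<in> C \<and> C \<inter> Z w = {}"
proof -
  define i where "i = (LEAST i. i < length w \<and> x i \<noteq> Letter (w ! i))"
  have "\<exists>i. i < length w \<and> x i \<noteq> Letter (w ! i)" using x by (auto simp: cylinder_def)
  then have i: "i < length w" "x i \<noteq> Letter (w ! i)"
    unfolding i_def by (metis (mono_tags, lifting) LeastI)+
  have before: "x j = Letter (w ! j)" if "j < i" for j
    using not_less_Least[of j "\<lambda>i. i < length w \<and> x i \<noteq> Letter (w ! i)"] that i(1)
    unfolding i_def by auto
  let ?u = "take i w"
  have u: "x \<in> Z ?u" using x(1) before i(1) by (simp add: cylinder_def)
  show ?thesis
  proof (cases "x i")
    case (Letter b)
    then have "x \<in> Z (?u @ [b])" using u i(1) by (simp add: cylinder_snoc)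
    moreover have "Z (?u @ [b]) \<inter> Z w = {}"
      using i Letter by (auto simp: cylinder_snoc) (auto simp: cylinder_def)
    ultimately show ?thesis using cylinder_in_cylinders by blast
  next
    case (Blur B)
    have B: "B \<in> V" using blur_point_eq(3)[of x ?u B] u i(1) Blur by (simp add: cylinder_def)
    let ?C = "blur_cylinder X V ?u B ({w ! i} \<inter> B)"
    have "x \<in> ?C" using u i(1) Blur by (simp add: blur_cylinder_def)
    moreover have "?C \<inter> Z w = {}" using i(1) by (auto simp: blur_cylinder_def cylinder_def)
    moreover have "?C \<in> cylinders"
      using B cylinder_nonempty_language[OF u] by (intro blur_cylinder_in_cylinders) auto
    ultimately show ?thesis by blast
  qed
qed

text \<open>Two distinct blur symbols \<open>B\<close> and \<open>D\<close> after the same word are separated by removing \<open>D \<inter> B\<close> from \<open>D\<close>;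
this is where the finiteness of the pairwise intersections of the blurred sets enters.\<close>

lemma cylinders_clopen:
  assumes "A \<in> cylinders"
  shows "openin T A \<and> closedin T A"
proof
  have op: "openin T C" if "C \<in> cylinders" for C
    unfolding blur_topology_cylinders using that by (rule topology_generated_by_Basis)
  then show "openin T A" using assms .
  have "\<exists>C\<in>cylinders. x \<in> C \<and> C \<inter> A = {}" if x: "x \<in> \<Omega>" "x \<notin> A" for x
  proof -
    consider w where "A = Z w"
      | w B S where "A = blur_cylinder X V w B S" "w \<in> language X" "B \<in> V" "S \<subseteq> B" "finite S"
      using assms by (auto simp: cylinders_def)
    then show ?thesis
    proof cases
      case 1
      then show ?thesis using separate_from_cylinder x by blast
    next
      case (2 w B S)
      show ?thesis
      proof (cases "x \<in> Z w")
        case False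
        then show ?thesis using separate_from_cylinder[OF x(1) False] 2(1) by (auto simp: blur_cylinder_def)
      next
        case True
        show ?thesis
        proof (cases "x (length w)")
          case (Letter a)
          then have "x \<in> Z (w @ [a])" using True by (simp add: cylinder_snoc)
          moreover have "Z (w @ [a]) \<inter> A = {}"
            using x 2(1) Letter True by (auto simp: cylinder_snoc blur_cylinder_def)
          ultimately show ?thesis using cylinder_in_cylinders by blast
        next
          case (Blur D)
          have D: "D \<in> V" using blur_point_eq(3)[of x w D] True Blur by (simp add: cylinder_def)
          have "D \<noteq> B" using x 2(1) True Blur by (auto simp: blur_cylinder_def)
          let ?C = "blur_cylinder X V w D (D \<inter> B)"
          have "x \<in> ?C" using True Blur by (simp add: blur_cylinder_def)
          moreover have "?C \<inter> A = {}" using \<open>D \<noteq> B\<close> 2(1) by (auto simp: blur_cylinder_def)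
          moreover have "?C \<in> cylinders"
            using D 2 V_finite_Int[OF D 2(3) \<open>D \<noteq> B\<close>] by (intro blur_cylinder_in_cylinders) auto
          ultimately show ?thesis by blast
        qed
      qed
    qed
  qed
  then have "topspace T - A \<subseteq> \<Union>{C \<in> cylinders. C \<inter> A = {}}"
    unfolding topspace_blur by blast
  moreover have "C \<subseteq> topspace T" if "C \<in> cylinders" for C using op[OF that] by (rule openin_subset)
  ultimately have "topspace T - A = \<Union>{C \<in> cylinders. C \<inter> A = {}}" by blast
  moreover have "openin T (\<Union>{C \<in> cylinders. C \<inter> A = {}})"
    by (rule openin_Union) (use op in simp)
  ultimately have "openin T (topspace T - A)" by simp
  moreover have "A \<subseteq> topspace T" using op[OF assms] openin_subset by blast
  ultimately show "closedin T A" by (simp add: closedin_def)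
qed

text \<open>A sequence all of whose prefixes are words is a pointwise limit of points of the shift space, which is closed.\<close>

lemma limit_of_words:
  assumes "\<And>n. map y [0..<n] \<in> language X"
  shows "y \<in> X"
proof -
  have "\<exists>x\<in>X. \<forall>i\<le>n. x i = y i" for n
  proof -
    from assms[of "Suc n"] obtain x where "x \<in> X" "map y [0..<Suc n] = map x [0..<Suc n]"
      by (auto simp: language_iff simp del: upt_Suc)
    then show ?thesis by (auto simp del: upt_Suc intro!: bexI[of _ x])
  qed
  then obtain x where x: "\<And>n. x n \<in> X" "\<And>n i. i \<le> n \<Longrightarrow> x n i = y i" by metis
  have "((\<lambda>n. x n i) \<longlongrightarrow> y i) sequentially" for i
    by (rule tendsto_eventually) (use x(2) in \<open>auto simp: eventually_sequentially\<close>)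
  then have "limitin (product_topology (\<lambda>i. euclidean) UNIV) x y sequentially"
    by (simp add: limitin_componentwise)
  then have "x \<longlonglongrightarrow> y" by (simp add: euclidean_product_topology)
  then show ?thesis using closed_sequentially[of X x y] x(1) shift by (auto simp: shift_space_def)
qed

text \<open>A Koenig-type argument. If every one-letter extension of \<open>w\<close> has a finitely covered cylinder, so has
\<open>w\<close>: each boundary point at \<open>w\<close> has a neighbourhood inside one member of the cover, and these
neighbourhoods contain all but finitely many of the extensions. So if the space were not finitely
covered, there would be an infinite sequence of letters none of whose prefixes is finitely covered.
It is a point of the shift space, and a member of the cover around it contains one of these
cylinders.\<close>

lemma compact_blur: "compact_space T"
  unfolding compact_space_alt
proof (intro allI impI)
  fix \<U> assume \<U>: "(\<forall>U\<in>\<U>. openin T U) \<and> topspace T \<subseteq> \<Union>\<U>"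
  define fc where "fc A \<longleftrightarrow> (\<exists>\<F>. finite \<F> \<and> \<F> \<subseteq> \<U> \<and> A \<subseteq> \<Union>\<F>)" for A
  have fc_UN: "fc (\<Union>i\<in>I. A i)" if "finite I" "\<And>i. i \<in> I \<Longrightarrow> fc (A i)" for I :: "'i set" and A
  proof -
    from that(2) obtain \<F> where
      "\<And>i. i \<in> I \<Longrightarrow> finite (\<F> i) \<and> \<F> i \<subseteq> \<U> \<and> A i \<subseteq> \<Union>(\<F> i)" unfolding fc_def by metis
    then show ?thesis unfolding fc_def using that(1)
      by (intro exI[of _ "\<Union>i\<in>I. \<F> i"]) blast
  qed
  have fc_Un: "fc (A \<union> B)" if "fc A" "fc B" for A B
    using that unfolding fc_def by (metis Un_mono Union_Un_distrib finite_UnI sup.boundedI)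
  have fc_mono: "fc A" if "fc B" "A \<subseteq> B" for A B using that unfolding fc_def by blast
  have fc_single: "fc A" if "U \<in> \<U>" "A \<subseteq> U" for A U
    unfolding fc_def using that by (intro exI[of _ "{U}"]) simp
  have step: "fc (Z w)" if fcw: "\<And>a. fc (Z (w @ [a]))" for w
  proof -
    define J where "J = {B \<in> V. infinite (followers X 1 w \<inter> B)}"
    have "\<exists>S. finite S \<and> fc (blur_cylinder X V w B S)" if "B \<in> J" "w \<in> language X" for B
    proof -
      have "boundary_point w B \<in> topspace T"
        using that boundary_point_in_blur_space by (simp add: J_def topspace_blur)
      then obtain U where U: "U \<in> \<U>" "boundary_point w B \<in> U" using \<U> by blast
      moreover have "openin T U" using U(1) \<U> by blast
      ultimately obtain S where "finite S" "blur_cylinder X V w B S \<subseteq> U"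
        using open_contains_blur_cylinder[of U w B] by blast
      then show ?thesis using fc_single[OF U(1)] by blast
    qed
    then obtain S where S: "\<And>B. B \<in> J \<Longrightarrow> w \<in> language X \<Longrightarrow>
        finite (S B) \<and> fc (blur_cylinder X V w B (S B))" by metis
    define R where "R = followers X 1 w - (\<Union>B\<in>J. B - S B)"
    show ?thesis
    proof (cases "w \<in> language X")
      case False
      then have "Z w = {}" using cylinder_nonempty_language by blast
      then show ?thesis by (auto simp: fc_def)
    next
      case True
      \<comment> \<open>A letter of \<open>R\<close> lies in no blurred set, or only in blurred sets that meet the followers of
        \<open>w\<close> in a finite set, or was removed from a neighbourhood; each case leaves finitely many.\<close>
      have "R \<subseteq> (letters X - \<Union>V) \<union> (\<Union>B\<in>V - J. followers X 1 w \<inter> B) \<union> (\<Union>B\<in>J. S B)"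
        by (auto simp: R_def followers_1)
      moreover have "finite (\<Union>B\<in>V - J. followers X 1 w \<inter> B)"
        by (rule finite_UN_I) (use finite_V in \<open>auto simp: J_def\<close>)
      moreover have "finite (\<Union>B\<in>J. S B)"
        by (rule finite_UN_I) (use finite_V S True in \<open>auto simp: J_def\<close>)
      ultimately have "finite R" using finite_uncovered by (meson finite_UnI finite_subset)
      have "finite J" using finite_V by (simp add: J_def)
      have "Z w \<subseteq> (\<Union>a\<in>R. Z (w @ [a])) \<union> (\<Union>B\<in>J. blur_cylinder X V w B (S B))"
      proof
        fix x assume x: "x \<in> Z w"
        then show "x \<in> (\<Union>a\<in>R. Z (w @ [a])) \<union> (\<Union>B\<in>J. blur_cylinder X V w B (S B))"
        proof (cases rule: cylinder_cases)
          case (letter a)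
          have "a \<in> followers X 1 w"
            using cylinder_nonempty_language[OF letter] language_last_letter by (simp add: followers_1)
          then consider "a \<in> R" | B where "B \<in> J" "a \<in> B - S B" by (auto simp: R_def)
          then show ?thesis
          proof cases
            case 2
            then have "x \<in> blur_cylinder X V w B (S B)"
              using letter by (auto simp: blur_cylinder_def cylinder_snoc)
            then show ?thesis using 2 by blast
          qed (use letter in blast)
        next
          case (blur B)
          then have "B \<in> J" by (simp add: J_def)
          moreover have "x \<in> blur_cylinder X V w B (S B)"
            using x blur(1) by (auto simp: blur_cylinder_def boundary_point_def)
          ultimately show ?thesis by blast
        qed
      qed
      moreover have "fc ((\<Union>a\<in>R. Z (w @ [a])) \<union> (\<Union>B\<in>J. blur_cylinder X V w B (S B)))"
      proof (rule fc_Un)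
        show "fc (\<Union>a\<in>R. Z (w @ [a]))" using \<open>finite R\<close> fcw by (rule fc_UN)
        show "fc (\<Union>B\<in>J. blur_cylinder X V w B (S B))"
          using \<open>finite J\<close> by (rule fc_UN) (use S True in blast)
      qed
      ultimately show ?thesis by (rule fc_mono[rotated])
    qed
  qed
  have "fc (Z [])"
  proof (rule ccontr)
    assume bad: "\<not> fc (Z [])"
    define g where "g w = (SOME a. \<not> fc (Z (w @ [a])))" for w
    have g: "\<not> fc (Z (w @ [g w]))" if "\<not> fc (Z w)" for w
      unfolding g_def using step[of w] that by (metis (mono_tags, lifting) someI_ex)
    define W where "W = rec_nat [] (\<lambda>n w. w @ [g w])"
    define y where "y n = g (W n)" for n
    have W0: "W 0 = []" and W_Suc: "W (Suc n) = W n @ [y n]" for n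
      by (simp_all add: W_def y_def)
    have W: "W n = map y [0..<n] \<and> \<not> fc (Z (W n))" for n
    proof (induction n)
      case 0
      then show ?case using bad by (simp add: W0)
    next
      case (Suc n)
      then have "\<not> fc (Z (W n))" by (rule conjunct2)
      from g[OF this] have "\<not> fc (Z (W n @ [y n]))" unfolding y_def .
      then show ?case using Suc by (simp add: W_Suc)
    qed
    have "fc {}" by (auto simp: fc_def)
    then have "Z (W n) \<noteq> {}" for n using W by metis
    then have "map y [0..<n] \<in> language X" for n
      using cylinder_nonempty_language[of _ "W n"] W[of n] by fastforce
    then have "y \<in> X" by (rule limit_of_words)
    then have "(\<lambda>i. Letter (y i)) \<in> topspace T" by (auto simp: topspace_blur blur_space_def)
    then obtain U where U: "U \<in> \<U>" "(\<lambda>i. Letter (y i)) \<in> U" using \<U> by blast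
    then obtain k where "Z (map y [0..<k]) \<subseteq> U"
      using open_contains_cylinder[of U y] \<U> by blast
    then have "fc (Z (W k))" using fc_single[OF U(1)] W by simp
    then show False using W by blast
  qed
  moreover have "topspace T = Z []" by (simp add: topspace_blur cylinder_def)
  ultimately show "\<exists>\<F>. finite \<F> \<and> \<F> \<subseteq> \<U> \<and> topspace T \<subseteq> \<Union>\<F>" by (simp add: fc_def)
qed

sublocale compact_clopen_base T cylinders
  by unfold_locales (auto simp: compact_blur countable_cylinders cylinders_clopen cylinders_base)

section \<open>The Borel sets and the shift map\<close>

definition blur_part :: "nat list \<Rightarrow> nat set \<Rightarrow> (nat \<Rightarrow> symbol) set" where
  "blur_part w B = {x \<in> Z w. x (length w) = Blur B}"

lemma blur_part_singleton: "x \<in> blur_part w B \<Longrightarrow> x = boundary_point w B"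
  using blur_point_eq(1)[of x w B] by (auto simp: blur_part_def cylinder_def)

text \<open>An intersection-stable generator of the Borel sets on which the effect of the shift is easy to compute.
The sets \<open>blur_part w B\<close> have at most one point; the cylinders of nonempty words alone would not
separate boundary points that differ only in their blur symbol. The whole space, which is the cylinder
of the empty word, is left out, since the shift does not pull it back to a union of longer cylinders.\<close>

definition markers :: "(nat \<Rightarrow> symbol) set set" where
  "markers = {Z w | w. w \<noteq> []} \<union> {blur_part w B | w B. B \<in> V} \<union> {{}}"

lemma markers_subset: "markers \<subseteq> Pow \<Omega>"
  by (auto simp: markers_def cylinder_def blur_part_def)

lemma cylinder_subset_cylinder:
  assumes "x \<in> Z w" "x \<in> Z u" "length w \<le> length u"
  shows "Z u \<subseteq> Z w"
proof
  fix y assume y: "y \<in> Z u"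
  have "w ! i = u ! i" if "i < length w" for i
    using assms that by (simp add: cylinder_def)
  then show "y \<in> Z w" using y assms(3) by (simp add: cylinder_def)
qed

lemma Int_stable_markers: "Int_stable markers"
proof (rule Int_stableI)
  fix A C assume AC: "A \<in> markers" "C \<in> markers"
  have single: "blur_part w B \<inter> D \<in> {blur_part w B, {}}" for w B D
    using blur_part_singleton by blast
  show "A \<inter> C \<in> markers"
  proof (cases "\<exists>w B. B \<in> V \<and> (A = blur_part w B \<or> C = blur_part w B)")
    case True
    then obtain w B where "B \<in> V" "A = blur_part w B \<or> C = blur_part w B" by blast
    moreover from this have "A \<inter> C \<in> {blur_part w B, {}}"
      using single[of w B A] single[of w B C] by (auto simp: Int_commute)
    ultimately show ?thesis by (auto simp: markers_def)
  next
    case False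
    show ?thesis
    proof (cases "A \<inter> C = {}")
      case nonempty: False
      from False AC nonempty obtain w u where "A = Z w" "C = Z u" by (auto simp: markers_def)
      then have "A \<subseteq> C \<or> C \<subseteq> A"
        using nonempty cylinder_subset_cylinder[of _ w u] cylinder_subset_cylinder[of _ u w]
        by (metis disjoint_iff linorder_le_cases)
      then have "A \<inter> C \<in> {A, C}" by auto
      then show ?thesis using AC by auto
    qed (simp add: markers_def)
  qed
qed

lemma Z_Nil: "Z [] = \<Omega>" by (simp add: cylinder_def)

lemma space_borel_prob: "M \<in> borel_probs T \<Longrightarrow> space M = \<Omega>"
  by (simp add: borel_probsD(3) topspace_blur)

lemma openin_cylinder: "openin T (Z w)" and closedin_cylinder: "closedin T (Z w)"
proof -
  have "openin T (Z w) \<and> closedin T (Z w)"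
  proof (cases "Z w = {}")
    case False
    then show ?thesis using cylinder_in_cylinders cylinders_clopen by blast
  qed simp
  then show "openin T (Z w)" "closedin T (Z w)" by auto
qed

lemma cylinder_sets: "M \<in> borel_probs T \<Longrightarrow> Z w \<in> sets M"
  using openin_in_sets_borel_prob openin_cylinder by blast

lemma blur_cylinder_eq:
  "blur_cylinder X V w B S = blur_part w B \<union> (\<Union>a\<in>B - S. Z (w @ [a]))"
  by (auto simp: blur_cylinder_def blur_part_def cylinder_snoc)

lemma blur_part_sets:
  assumes M: "M \<in> borel_probs T" and B: "B \<in> V"
  shows "blur_part w B \<in> sets M"
proof (cases "w \<in> language X")
  case True
  have "blur_part w B = blur_cylinder X V w B {} - (\<Union>a\<in>B. Z (w @ [a]))"
    unfolding blur_cylinder_eq by (auto simp: blur_part_def cylinder_snoc)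
  moreover have "blur_cylinder X V w B {} \<in> sets M"
    using openin_in_sets_borel_prob[OF M] cylinders_clopen blur_cylinder_in_cylinders[OF True B]
    by blast
  moreover have "(\<Union>a\<in>B. Z (w @ [a])) \<in> sets M"
    using cylinder_sets[OF M] by (intro sets.countable_UN') auto
  ultimately show ?thesis by simp
next
  case False
  then have "blur_part w B = {}" using cylinder_nonempty_language by (auto simp: blur_part_def)
  then show ?thesis by simp
qed

lemma sets_borel_prob_markers:
  assumes M: "M \<in> borel_probs T"
  shows "sets M = sigma_sets \<Omega> markers"
proof
  have "markers \<subseteq> sets M"
    using cylinder_sets[OF M] blur_part_sets[OF M] by (auto simp: markers_def)
  then show "sigma_sets \<Omega> markers \<subseteq> sets M"
    using sets.sigma_sets_subset[of markers M] space_borel_prob[OF M] by simp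
  interpret S: sigma_algebra \<Omega> "sigma_sets \<Omega> markers"
    by (rule sigma_algebra_sigma_sets) (rule markers_subset)
  have Zs: "Z w \<in> sigma_sets \<Omega> markers" for w
  proof (cases "w = []")
    case True
    then show ?thesis using S.top by (simp add: Z_Nil)
  next
    case False
    then show ?thesis by (intro sigma_sets.Basic) (auto simp: markers_def)
  qed
  have "C \<in> sigma_sets \<Omega> markers" if "C \<in> cylinders" for C
  proof -
    consider w where "C = Z w" | w B S where "C = blur_cylinder X V w B S" "B \<in> V"
      using \<open>C \<in> cylinders\<close> by (auto simp: cylinders_def)
    then show ?thesis
    proof cases
      case (2 w B S)
      have "blur_part w B \<in> sigma_sets \<Omega> markers"
        using 2(2) by (intro sigma_sets.Basic) (auto simp: markers_def)
      moreover have "(\<Union>a\<in>B - S. Z (w @ [a])) \<in> sigma_sets \<Omega> markers"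
        using Zs by (intro S.countable_UN') auto
      ultimately show ?thesis unfolding 2(1) blur_cylinder_eq by (rule S.Un)
    qed (use Zs in simp)
  qed
  then show "sets M \<subseteq> sigma_sets \<Omega> markers"
    unfolding borel_probsD(2)[OF M] sets_borel_of_base topspace_blur
    by (intro sigma_sets_mono) auto
qed

lemma letter_before_letter:
  assumes "x \<in> \<Omega>" "x j = Letter b" "i \<le> j"
  obtains a where "x i = Letter a"
  using assms(1)
proof (cases rule: blur_space_cases)
  case (point y)
  then show ?thesis using that by simp
next
  case (boundary w B)
  have "j < length w" using assms(2) boundary(4) by (simp add: boundary_point_def split: if_splits)
  then show ?thesis using that[of "w ! i"] assms(3) boundary(4) by (simp add: boundary_point_def)
qed

lemma left_shift_preimage_cylinder:
  assumes "w \<noteq> []"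
  shows "left_shift -` Z w \<inter> \<Omega> = (\<Union>a. Z (a # w))"
proof
  show "(\<Union>a. Z (a # w)) \<subseteq> left_shift -` Z w \<inter> \<Omega>"
    using left_shift_blur_space by (force simp: cylinder_def left_shift_def)
  show "left_shift -` Z w \<inter> \<Omega> \<subseteq> (\<Union>a. Z (a # w))"
  proof
    fix x assume x: "x \<in> left_shift -` Z w \<inter> \<Omega>"
    then have "x (Suc 0) = Letter (w ! 0)"
      using assms by (simp add: cylinder_def left_shift_def)
    then obtain a where "x 0 = Letter a" using x letter_before_letter[of x "Suc 0" _ 0] by auto
    then have "x \<in> Z (a # w)" using x by (auto simp: cylinder_def left_shift_def nth_Cons split: nat.split)
    then show "x \<in> (\<Union>a. Z (a # w))" by blast
  qed
qed

lemma left_shift_preimage_blur_part: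
  "left_shift -` blur_part w B \<inter> \<Omega> =
     (\<Union>a. blur_part (a # w) B) \<union> (if w = [] then blur_part [] B else {})"
proof
  show "(\<Union>a. blur_part (a # w) B) \<union> (if w = [] then blur_part [] B else {})
      \<subseteq> left_shift -` blur_part w B \<inter> \<Omega>"
  proof -
    have "left_shift x \<in> blur_part w B \<and> x \<in> \<Omega>" if "x \<in> blur_part (a # w) B" for x a
      using that left_shift_blur_space by (force simp: blur_part_def cylinder_def left_shift_def)
    moreover have "left_shift x \<in> blur_part [] B \<and> x \<in> \<Omega>" if x: "x \<in> blur_part [] B" for x
    proof -
      have "x = boundary_point [] B" using x by (rule blur_part_singleton)
      then have "left_shift x = x" by (simp add: boundary_point_def left_shift_def)
      then show ?thesis using x by (simp add: blur_part_def cylinder_def)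
    qed
    ultimately show ?thesis by (auto split: if_splits)
  qed
  show "left_shift -` blur_part w B \<inter> \<Omega>
      \<subseteq> (\<Union>a. blur_part (a # w) B) \<union> (if w = [] then blur_part [] B else {})"
  proof
    fix x assume x: "x \<in> left_shift -` blur_part w B \<inter> \<Omega>"
    show "x \<in> (\<Union>a. blur_part (a # w) B) \<union> (if w = [] then blur_part [] B else {})"
    proof (cases "x 0")
      case (Letter a)
      then have "x \<in> blur_part (a # w) B"
        using x by (auto simp: blur_part_def cylinder_def left_shift_def nth_Cons split: nat.split)
      then show ?thesis by blast
    next
      case (Blur C)
      then have c: "x = boundary_point [] C" using x blur_point_eq(1)[of x "[]" C] by simp
      have "w = []"
      proof (rule ccontr)
        assume "w \<noteq> []"
        then have "x (Suc 0) = Letter (w ! 0)"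
          using x by (simp add: blur_part_def cylinder_def left_shift_def)
        then show False by (simp add: c boundary_point_def)
      qed
      moreover have "x \<in> blur_part [] B"
        using x c \<open>w = []\<close> by (auto simp: blur_part_def cylinder_def left_shift_def boundary_point_def)
      ultimately show ?thesis by simp
    qed
  qed
qed

lemma left_shift_measurable:
  assumes M: "M \<in> borel_probs T"
  shows "left_shift \<in> measurable M M"
proof (rule measurable_sigma_sets[OF sets_borel_prob_markers[OF M] markers_subset])
  show "left_shift \<in> space M \<rightarrow> \<Omega>"
    using left_shift_blur_space by (auto simp: space_borel_prob[OF M])
  fix A assume "A \<in> markers"
  then consider w where "A = Z w" "w \<noteq> []" | w B where "A = blur_part w B" "B \<in> V" | "A = {}"
    by (auto simp: markers_def)
  then show "left_shift -` A \<inter> space M \<in> sets M"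
  proof cases
    case 1
    then show ?thesis
      using cylinder_sets[OF M]
      by (simp add: space_borel_prob[OF M] left_shift_preimage_cylinder sets.countable_UN)
  next
    case 2
    have "(\<Union>a. blur_part (a # w) B) \<in> sets M" for w
      using blur_part_sets[OF M 2(2)] by (intro sets.countable_UN) auto
    then show ?thesis
      using blur_part_sets[OF M 2(2)] 2(1)
      by (simp add: space_borel_prob[OF M] left_shift_preimage_blur_part)
  qed simp
qed

text \<open>The union over initial words makes the measure of this set a sum over cylinders.\<close>

definition letters_upto :: "nat \<Rightarrow> (nat \<Rightarrow> symbol) set" where
  "letters_upto k = (\<Union>w\<in>{w. length w = k}. Z w)"

lemma letters_upto_iff: "x \<in> letters_upto k \<longleftrightarrow> x \<in> \<Omega> \<and> (\<forall>i<k. \<exists>a. x i = Letter a)"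
proof
  assume "x \<in> \<Omega> \<and> (\<forall>i<k. \<exists>a. x i = Letter a)"
  then obtain a where "x \<in> \<Omega>" "\<And>i. i < k \<Longrightarrow> x i = Letter (a i)" by metis
  then have "x \<in> Z (map a [0..<k])" by (simp add: in_cylinder_map)
  then show "x \<in> letters_upto k" by (force simp: letters_upto_def)
qed (auto simp: letters_upto_def cylinder_def)

lemma left_shift_preimage_letters_upto:
  assumes "k \<ge> 1"
  shows "left_shift -` letters_upto k \<inter> \<Omega> = letters_upto (Suc k)"
proof -
  have "(\<forall>i<k. \<exists>a. x (Suc i) = Letter a) \<longleftrightarrow> (\<forall>i<Suc k. \<exists>a. x i = Letter a)" if x: "x \<in> \<Omega>" for x
  proof
    assume *: "\<forall>i<k. \<exists>a. x (Suc i) = Letter a"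
    then obtain b where "x (Suc 0) = Letter b" using assms by auto
    then obtain a where "x 0 = Letter a" using letter_before_letter[OF x, of "Suc 0" b 0] by auto
    then show "\<forall>i<Suc k. \<exists>a. x i = Letter a" using * by (metis Suc_less_eq gr0_conv_Suc not_gr_zero)
  qed auto
  then show ?thesis
    using left_shift_blur_space by (auto simp: letters_upto_iff left_shift_def set_eq_iff)
qed

lemma letters_upto_sets: "M \<in> borel_probs T \<Longrightarrow> letters_upto k \<in> sets M"
  unfolding letters_upto_def using cylinder_sets by (intro sets.countable_UN') auto

text \<open>An invariant probability cannot charge boundary points of positive length: the sets \<open>letters_upto k\<close>
with \<open>k \<ge> 1\<close> are pulled back to one another by the shift, so they all have the same measure, and the
boundary points of length \<open>k\<close> lie in the difference of two consecutive ones. Invariance on cylinders of nonempty words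
is enough for this, so it is available before invariance on all Borel sets is known.\<close>

lemma blur_part_null:
  assumes M: "M \<in> borel_probs T" and B: "B \<in> V" and w: "w \<noteq> []"
    and inv: "\<And>w. w \<noteq> [] \<Longrightarrow> emeasure M (left_shift -` Z w \<inter> space M) = emeasure M (Z w)"
  shows "blur_part w B \<in> null_sets M"
proof -
  interpret prob_space M using borel_probsD(1)[OF M] .
  let ?N = "distr M M left_shift"
  let ?k = "length w"
  let ?W = "{w::nat list. length w = ?k}"
  note meas = left_shift_measurable[OF M]
  have disj: "disjoint_family_on Z ?W"
    unfolding disjoint_family_on_def
  proof (intro ballI impI, rule ccontr)
    fix u v assume uv: "u \<in> ?W" "v \<in> ?W" "u \<noteq> v" "Z u \<inter> Z v \<noteq> {}"
    then obtain x where "x \<in> Z u" "x \<in> Z v" by blast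
    then have "u = v" using uv(1,2) by (intro nth_equalityI) (auto simp: cylinder_def)
    then show False using uv(3) by blast
  qed
  have "emeasure ?N (letters_upto ?k) = (\<integral>\<^sup>+u. emeasure ?N (Z u) \<partial>count_space ?W)"
    unfolding letters_upto_def
    using disj cylinder_sets[OF M] by (intro emeasure_UN_countable) auto
  also have "\<dots> = (\<integral>\<^sup>+u. emeasure M (Z u) \<partial>count_space ?W)"
  proof (rule nn_integral_cong)
    fix u assume "u \<in> space (count_space ?W)"
    then have "u \<noteq> []" using w by auto
    then show "emeasure ?N (Z u) = emeasure M (Z u)"
      using inv cylinder_sets[OF M] meas by (simp add: emeasure_distr)
  qed
  also have "\<dots> = emeasure M (letters_upto ?k)"
    unfolding letters_upto_def
    using disj cylinder_sets[OF M] by (intro emeasure_UN_countable[symmetric]) auto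
  finally have eq: "emeasure M (letters_upto (Suc ?k)) = emeasure M (letters_upto ?k)"
    using left_shift_preimage_letters_upto[of ?k] w meas letters_upto_sets[OF M, of ?k]
    by (simp add: emeasure_distr space_borel_prob[OF M] Suc_le_eq)
  have "letters_upto (Suc ?k) \<subseteq> letters_upto ?k" by (auto simp: letters_upto_iff)
  then have "emeasure M (letters_upto ?k - letters_upto (Suc ?k)) = 0"
    using eq letters_upto_sets[OF M] by (simp add: emeasure_Diff)
  then have "letters_upto ?k - letters_upto (Suc ?k) \<in> null_sets M"
    using letters_upto_sets[OF M] by auto
  moreover have "blur_part w B \<subseteq> letters_upto ?k - letters_upto (Suc ?k)"
    by (force simp: blur_part_def cylinder_def letters_upto_iff)
  ultimately show ?thesis using blur_part_sets[OF M B] by (metis null_sets_subset)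
qed

text \<open>By uniqueness of measures it suffices to compare the probability with its push-forward on the
generator. On the parts \<open>blur_part w B\<close> the two agree because they differ by null sets; for empty \<open>w\<close>
the point is fixed by the shift, and its other preimages have length one.\<close>

lemma invariant_if_cylinders:
  assumes M: "M \<in> borel_probs T"
    and inv: "\<And>w. w \<noteq> [] \<Longrightarrow> measure M (left_shift -` Z w \<inter> space M) = measure M (Z w)"
  shows "M \<in> invariant_probs T left_shift"
proof -
  interpret prob_space M using borel_probsD(1)[OF M] .
  note meas = left_shift_measurable[OF M]
  have inv': "emeasure M (left_shift -` Z w \<inter> space M) = emeasure M (Z w)" if "w \<noteq> []" for w
    using inv[OF that] by (simp add: emeasure_eq_measure)
  note null = blur_part_null[OF M _ _ inv']
  have "distr M M left_shift = M"
  proof (rule measure_eqI_generator_eq_countable)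
    let ?A = "range (\<lambda>a. Z [a]) \<union> blur_part [] ` V"
    show "Int_stable markers" by (rule Int_stable_markers)
    show "markers \<subseteq> Pow \<Omega>" by (rule markers_subset)
    show "sets (distr M M left_shift) = sigma_sets \<Omega> markers" "sets M = sigma_sets \<Omega> markers"
      using sets_borel_prob_markers[OF M] by auto
    show "?A \<subseteq> markers" by (auto simp: markers_def)
    show "countable ?A" using finite_V by (auto simp: countable_finite)
    show "\<Union>?A = \<Omega>"
    proof
      show "\<Union>?A \<subseteq> \<Omega>" by (auto simp: cylinder_def blur_part_def)
      show "\<Omega> \<subseteq> \<Union>?A"
      proof
        fix x assume "x \<in> \<Omega>"
        then have x: "x \<in> Z []" by (simp add: Z_Nil)
        then show "x \<in> \<Union>?A"
        proof (cases rule: cylinder_cases)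
          case (blur B)
          then have "x \<in> blur_part [] B" using x by (auto simp: blur_part_def boundary_point_def)
          then show ?thesis using blur by blast
        qed auto
      qed
    qed
    show "emeasure (distr M M left_shift) A \<noteq> \<infinity>" if "A \<in> ?A" for A
    proof -
      interpret D: prob_space "distr M M left_shift" by (rule prob_space_distr[OF meas])
      show ?thesis by simp
    qed
    fix A assume "A \<in> markers"
    then consider w where "A = Z w" "w \<noteq> []" | w B where "A = blur_part w B" "B \<in> V" | "A = {}"
      by (auto simp: markers_def)
    then show "emeasure (distr M M left_shift) A = emeasure M A"
    proof cases
      case 1
      then show ?thesis using inv' cylinder_sets[OF M] meas by (simp add: emeasure_distr)
    next
      case (2 w B)
      have U: "(\<Union>a. blur_part (a # w) B) \<in> null_sets M"
        using null[OF 2(2)] by (intro null_sets_UN) simp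
      have "emeasure (distr M M left_shift) A = emeasure M (left_shift -` blur_part w B \<inter> \<Omega>)"
        using blur_part_sets[OF M 2(2)] meas 2(1)
        by (simp add: emeasure_distr space_borel_prob[OF M])
      also have "\<dots> = emeasure M (if w = [] then blur_part [] B else {})"
        unfolding left_shift_preimage_blur_part
        using U blur_part_sets[OF M 2(2)] by (subst Un_commute, intro emeasure_Un_null_set) auto
      also have "\<dots> = emeasure M A"
        using null[OF 2(2), of w] 2(1) by auto
      finally show ?thesis .
    qed simp
  qed
  then have "emeasure M (left_shift -` A \<inter> space M) = emeasure M A" if "A \<in> sets M" for A
    using emeasure_distr[OF meas that] by simp
  then show ?thesis using M by (simp add: invariant_probs_def measure_def)
qed

section \<open>Invariance as a closed condition\<close>

text \<open>\<open>N\<close> is so large that two occurrences of \<open>c\<close> preceded by letters greater than \<open>N\<close> are at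
least \<open>k\<close> steps apart. The bound \<open>c \<le> N\<close> takes care of return
time 1, where the two occurrences would overlap and make \<open>c\<close> itself one of these letters.\<close>

definition separating :: "nat \<Rightarrow> nat \<Rightarrow> nat \<Rightarrow> bool" where
  "separating c k N \<longleftrightarrow>
     c \<le> N \<and> (\<forall>m\<in>{1..k}. \<forall>a\<in>predecessors X [c] \<inter> followers X m [c]. a \<le> N)"

definition large_before :: "nat \<Rightarrow> nat \<Rightarrow> nat \<Rightarrow> (nat \<Rightarrow> symbol) set" where
  "large_before c N j = {x \<in> \<Omega>. \<exists>a>N. x j = Letter a \<and> x (Suc j) = Letter c}"

text \<open>If a letter greater than \<open>N\<close> precedes \<open>c\<close> at position \<open>i\<close> and again, as the letter \<open>a\<close>, at
position \<open>j\<close>, then the word \<open>c v a c\<close> is read from position \<open>i + 1\<close> on (unless \<open>j = i + 1\<close>, when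
\<open>a = c > N\<close>). So \<open>a\<close> is a
predecessor of \<open>c\<close> that also follows \<open>c\<close> after \<open>j - i - 1\<close> steps.\<close>

lemma large_before_disjoint:
  assumes sep: "separating c k N" and ij: "i < j" "j < k"
  shows "large_before c N i \<inter> large_before c N j = {}"
proof (rule ccontr)
  assume "large_before c N i \<inter> large_before c N j \<noteq> {}"
  then obtain x a where x: "x \<in> \<Omega>" "x (Suc i) = Letter c" "a > N" "x j = Letter a"
      "x (Suc j) = Letter c" by (auto simp: large_before_def)
  have "\<exists>b. x t = Letter b" if "t \<le> Suc j" for t
    using letter_before_letter[OF x(1,5) that] by blast
  then obtain y where y: "\<And>t. t \<le> Suc j \<Longrightarrow> x t = Letter (y t)" by metis
  have yv: "y (Suc i) = c" "y j = a" "y (Suc j) = c" using y[of "Suc i"] y[of j] y[of "Suc j"] x ij by auto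
  have "j \<noteq> Suc i" using yv x(3) sep by (auto simp: separating_def)
  then have j: "Suc (Suc i) \<le> j" using ij by simp
  have L: "map y [0..<Suc (Suc j)] \<in> language X"
    using x(1) by (rule prefix_in_language) (use y in \<open>simp del: upt_Suc\<close>)
  let ?v = "map y [Suc (Suc i)..<j]"
  have "[0..<j] = [0..<Suc i] @ [Suc i..<j]"
    using upt_add_eq_append[of 0 "Suc i" "j - Suc i"] j by (simp del: upt_Suc)
  then have "[0..<Suc (Suc j)] = [0..<Suc i] @ [Suc i..<j] @ [j, Suc j]" by simp
  also have "[Suc i..<j] = Suc i # [Suc (Suc i)..<j]" using j by (simp add: upt_conv_Cons)
  finally have split: "map y [0..<Suc (Suc j)] = map y [0..<Suc i] @ ([c] @ ?v @ [a]) @ [c]"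
    using yv by (simp del: upt_Suc)
  have cva: "[c] @ ?v @ [a] \<in> language X" using L unfolding split by (rule language_factor)
  then have "?v \<in> language X" by (rule language_factor)
  moreover have "a \<in> letters X" using cva language_last_letter[of "[c] @ ?v" a] by simp
  moreover have "[a, c] \<in> language X"
    using L language_suffix[of "map y [0..<Suc i] @ [c] @ ?v" "[a, c]"] unfolding split by simp
  ultimately have "a \<in> predecessors X [c] \<inter> followers X (j - Suc i) [c]"
    using cva j by (simp add: predecessors_def followers_def words_iff) (auto intro!: bexI[of _ ?v] simp: words_iff)
  moreover have "j - Suc i \<in> {1..k}" using j ij by auto
  ultimately show False using sep x(3) by (force simp: separating_def)
qed

lemma large_before_0: "large_before c N 0 = (\<Union>a\<in>{N<..}. Z [a, c])"
  by (auto simp: large_before_def cylinder_def less_Suc_eq)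

lemma large_before_Suc: "large_before c N (Suc j) = left_shift -` large_before c N j \<inter> \<Omega>"
  using left_shift_blur_space by (auto simp: large_before_def left_shift_def)

text \<open>The first \<open>k\<close> preimages of the set under the shift are disjoint and have the same measure.\<close>

lemma large_before_measure_le:
  assumes M: "M \<in> invariant_probs T left_shift" and sep: "separating c k N" and k: "k \<ge> 1"
  shows "measure M (large_before c N 0) \<le> 1 / k"
proof -
  have MB: "M \<in> borel_probs T" using M by (simp add: invariant_probs_def)
  interpret prob_space M using borel_probsD(1)[OF MB] .
  have "large_before c N j \<in> sets M \<and>
      measure M (large_before c N j) = measure M (large_before c N 0)" for j
  proof (induction j)
    case 0
    have "large_before c N 0 \<in> sets M"
      unfolding large_before_0 using cylinder_sets[OF MB] by (intro sets.countable_UN') auto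
    then show ?case by simp
  next
    case (Suc j)
    have "left_shift -` large_before c N j \<inter> space M \<in> sets M"
      using measurable_sets[OF left_shift_measurable[OF MB]] Suc by blast
    then show ?case
      using Suc M unfolding large_before_Suc
      by (auto simp: invariant_probs_def space_borel_prob[OF MB])
  qed
  note B = this
  have "disjoint_family_on (large_before c N) {..<k}"
    unfolding disjoint_family_on_def
  proof (intro ballI impI)
    fix i j assume "i \<in> {..<k}" "j \<in> {..<k}" "i \<noteq> j"
    then show "large_before c N i \<inter> large_before c N j = {}"
      using large_before_disjoint[OF sep, of i j] large_before_disjoint[OF sep, of j i]
      by (auto simp: neq_iff)
  qed
  then have "measure M (\<Union>j\<in>{..<k}. large_before c N j) = (\<Sum>j<k. measure M (large_before c N j))"
    using B by (intro finite_measure_finite_Union) auto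
  also have "\<dots> = (\<Sum>j<k. measure M (large_before c N 0))"
    using B by (intro sum.cong) auto
  also have "\<dots> = k * measure M (large_before c N 0)" by simp
  finally have "k * measure M (large_before c N 0) \<le> 1" using prob_le_1 by metis
  then show ?thesis using k by (simp add: field_simps)
qed

definition truncated_preimage :: "nat list \<Rightarrow> nat \<Rightarrow> (nat \<Rightarrow> symbol) set" where
  "truncated_preimage w N = (\<Union>a\<le>N. Z (a # w))"

lemma truncated_preimage_clopen: "openin T (truncated_preimage w N)" "closedin T (truncated_preimage w N)"
  unfolding truncated_preimage_def
  by (auto intro!: openin_Union closedin_Union simp: openin_cylinder closedin_cylinder)

text \<open>The preimage of a cylinder is a countable union of cylinders, so its measure need not depend
continuously on the probability: mass can escape along letters that tend to infinity.
Truncating the union at \<open>N\<close> gives a clopen set, and the truncation error is bounded by \<open>1 / k\<close> uniformly over all invariant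
probabilities. These bounds are closed conditions, and letting first \<open>N\<close> and then \<open>k\<close> tend to
infinity recovers invariance.\<close>

lemma invariant_probs_eq:
  assumes fin: "\<And>c k. \<exists>N0. \<forall>N\<ge>N0. separating c k N"
  shows "invariant_probs T left_shift = borel_probs T \<inter>
     (\<Inter>(c, u, k, N) \<in> {(c, u, k, N). k \<ge> 1 \<and> separating c k N}.
        {M \<in> borel_probs T. \<bar>measure M (truncated_preimage (c # u) N) - measure M (Z (c # u))\<bar> \<le> 1 / real k})"
    (is "_ = ?R")
proof
  show "invariant_probs T left_shift \<subseteq> ?R"
  proof
    fix M assume M: "M \<in> invariant_probs T left_shift"
    then have MB: "M \<in> borel_probs T" by (simp add: invariant_probs_def)
    interpret prob_space M using borel_probsD(1)[OF MB] .
    have "\<bar>measure M (truncated_preimage (c # u) N) - measure M (Z (c # u))\<bar> \<le> 1 / real k"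
      if k: "k \<ge> 1" and sep: "separating c k N" for c u k N
    proof -
      let ?A = "truncated_preimage (c # u) N" and ?E = "large_before c N 0"
      have A: "?A \<in> sets M" using openin_in_sets_borel_prob[OF MB] truncated_preimage_clopen by blast
      have E: "?E \<in> sets M"
        unfolding large_before_0 using cylinder_sets[OF MB] by (intro sets.countable_UN') auto
      have Zs: "(\<Union>a. Z (a # c # u)) \<in> sets M"
        using cylinder_sets[OF MB] by (intro sets.countable_UN) auto
      have "measure M (Z (c # u)) = measure M (left_shift -` Z (c # u) \<inter> space M)"
        using M cylinder_sets[OF MB] by (simp add: invariant_probs_def)
      also have "\<dots> = measure M (\<Union>a. Z (a # c # u))"
        by (simp add: space_borel_prob[OF MB] left_shift_preimage_cylinder)
      finally have eq: "measure M (Z (c # u)) = measure M (\<Union>a. Z (a # c # u))" .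
      have "Z (a # c # u) \<subseteq> ?A \<union> ?E" for a
      proof (cases "a \<le> N")
        case False
        then show ?thesis by (force simp: large_before_def cylinder_def)
      qed (auto simp: truncated_preimage_def)
      then have "measure M (\<Union>a. Z (a # c # u)) \<le> measure M (?A \<union> ?E)"
        using A E by (intro finite_measure_mono) auto
      also have "\<dots> \<le> measure M ?A + measure M ?E" using A E by (rule measure_Un_le)
      also have "measure M ?E \<le> 1 / k" by (rule large_before_measure_le[OF M sep k])
      finally have "measure M (Z (c # u)) \<le> measure M ?A + 1 / k" by (simp add: eq)
      moreover have "measure M ?A \<le> measure M (\<Union>a. Z (a # c # u))"
        using Zs by (intro finite_measure_mono) (auto simp: truncated_preimage_def)
      ultimately show ?thesis using eq by simp
    qed
    then show "M \<in> ?R" using MB by auto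
  qed
  show "?R \<subseteq> invariant_probs T left_shift"
  proof
    fix M assume M: "M \<in> ?R"
    then have MB: "M \<in> borel_probs T" by blast
    interpret prob_space M using borel_probsD(1)[OF MB] .
    show "M \<in> invariant_probs T left_shift"
    proof (rule invariant_if_cylinders[OF MB])
      fix w :: "nat list" assume w: "w \<noteq> []"
      then obtain c u where cu: "w = c # u" by (cases w) auto
      have UN: "(\<Union>N. truncated_preimage w N) = left_shift -` Z w \<inter> space M"
        by (auto simp: truncated_preimage_def space_borel_prob[OF MB] left_shift_preimage_cylinder[OF w])
      have "(\<lambda>N. measure M (truncated_preimage w N)) \<longlonglongrightarrow> measure M (\<Union>N. truncated_preimage w N)"
        using openin_in_sets_borel_prob[OF MB truncated_preimage_clopen(1)]
        by (intro finite_Lim_measure_incseq) (force simp: incseq_def truncated_preimage_def)+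
      then have lim: "(\<lambda>N. \<bar>measure M (truncated_preimage w N) - measure M (Z w)\<bar>) \<longlonglongrightarrow>
          \<bar>measure M (left_shift -` Z w \<inter> space M) - measure M (Z w)\<bar>"
        unfolding UN by (intro tendsto_intros)
      have "\<bar>measure M (left_shift -` Z w \<inter> space M) - measure M (Z w)\<bar> \<le> 1 / real k" if "k \<ge> 1" for k
      proof -
        obtain N0 where "\<And>N. N \<ge> N0 \<Longrightarrow> separating c k N" using fin by blast
        then have "\<bar>measure M (truncated_preimage w N) - measure M (Z w)\<bar> \<le> 1 / real k"
          if "N \<ge> N0" for N
          using M that \<open>k \<ge> 1\<close> unfolding cu by blast
        then show ?thesis using lim by (intro LIMSEQ_le_const2) auto
      qed
      then have "\<bar>measure M (left_shift -` Z w \<inter> space M) - measure M (Z w)\<bar> \<le> 0"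
        by (intro LIMSEQ_le_const[OF lim_1_over_n]) auto
      then show "measure M (left_shift -` Z w \<inter> space M) = measure M (Z w)" by simp
    qed
  qed
qed

lemma compactin_invariant_probs:
  assumes fin: "\<And>c k. \<exists>N0. \<forall>N\<ge>N0. separating c k N"
  shows "compactin (weak_star T) (invariant_probs T left_shift)"
proof (rule closed_compactin[OF compactin_borel_probs])
  show "invariant_probs T left_shift \<subseteq> borel_probs T" by (auto simp: invariant_probs_def)
  let ?F = "\<lambda>(c, u, k, N). {M \<in> borel_probs T.
      \<bar>measure M (truncated_preimage (c # u) N) - measure M (Z (c # u))\<bar> \<le> 1 / real k}"
  let ?I = "{(c, u, k, N). k \<ge> 1 \<and> separating c k N}"
  have "closedin (weak_star T) (?F p)" for p
    by (cases p)
       (simp add: closedin_weak_star_measure_diff_le truncated_preimage_clopen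
          openin_cylinder closedin_cylinder)
  moreover have "closedin (weak_star T) (borel_probs T)"
    using closedin_topspace[of "weak_star T"] by simp
  ultimately have "closedin (weak_star T) (\<Inter>(insert (borel_probs T) (?F ` ?I)))"
    by (intro closedin_Inter) blast+
  then show "closedin (weak_star T) (invariant_probs T left_shift)"
    unfolding invariant_probs_eq[OF fin] by simp
qed

lemma eventually_separating:
  assumes "\<And>a m. a \<in> letters X \<Longrightarrow> m \<ge> 1 \<Longrightarrow> finite (predecessors X [a] \<inter> followers X m [a])"
  shows "\<exists>N0. \<forall>N\<ge>N0. separating c k N"
proof -
  have "finite (predecessors X [c] \<inter> followers X m [c])" if "m \<ge> 1" for m
  proof (cases "c \<in> letters X")
    case False
    then have "predecessors X [c] = {}"
      using language_suffix[of "[_]" "[c]"] by (auto simp: predecessors_def letters_iff)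
    then show ?thesis by simp
  qed (use assms that in blast)
  then have "finite (\<Union>m\<in>{1..k}. predecessors X [c] \<inter> followers X m [c])"
    by (intro finite_UN_I) auto
  then have "finite (insert c (\<Union>m\<in>{1..k}. predecessors X [c] \<inter> followers X m [c]))"
    by (rule finite.insertI)
  then obtain N0 where "\<forall>a\<in>insert c (\<Union>m\<in>{1..k}. predecessors X [c] \<inter> followers X m [c]). a \<le> N0"
    using finite_nat_set_iff_bounded_le by blast
  then have "separating c k N" if "N \<ge> N0" for N
    using that by (force simp: separating_def)
  then show ?thesis by blast
qed

end

theorem corollary3p10:
  fixes X :: "(nat \<Rightarrow> nat) set" and V :: "nat set set"
  assumes "shift_space X"
    and "\<And>a m. a \<in> letters X \<Longrightarrow> m \<ge> 1 \<Longrightarrow>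
           finite (predecessors X [a] \<inter> followers X m [a])"
    and "invariant_probs (top_of_set X) left_shift
           \<subseteq> weak_star (top_of_set X) closure_of periodic_orbit_probs (top_of_set X) left_shift"
    and "finite_resolution X V"
  shows "compactin (weak_star (blur_topology X V))
           (invariant_probs (blur_topology X V) left_shift)"
proof -
  interpret blur_shift X V by unfold_locales (fact assms)+
  show ?thesis
    by (rule compactin_invariant_probs) (rule eventually_separating, fact assms(2))
qed

end
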